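(* Let $d\ge 1$ be an integer, let $\{q_i\}_{i\ge1}$ be the set of edges of the lattice $\mathbb{Z}^d$, and let $t(q_1),t(q_2),\ldots$ be independent (not necessarily identically distributed) random passage times such that $$\sup_{i\ge1}\mathbb{P}(t(q_i)\le\epsilon)\longrightarrow 0\ \text{ as }\ \epsilon\downarrow0\qquad\text{and}\qquad \mu_2:=\sup_{i\ge1}\mathbb{E}t^2(q_i)<\infty.$$ Let $T_n(k)$ and $T_n$ be the $k$-constrained and the unconstrained minimum passage times between the origin and $(n,\mathbf{0})$. In what follows, $n\ge 1$ and $k$ are integers and constants do not depend on $n$ or $k$. (a) There are constants $C_1,C_2>0$ such that for every $k\ge n$: $$\mathbb{P}\left(C_1n\le T_n\le T_n(k)\le C_2n\right)\ge 1-\frac{C_2}{n},\qquad \mathrm{var}(T_n(k))\le C_2n,$$ and $C_1n\le\mathbb{E}T_n\le\mathbb{E}T_n(k)\le C_2n$. (b) There exists a constant $C_3>0$ such that if $k\ge C_3n$ then $\mathbb{P}(T_n\ne T_n(k))\le \frac{C_3}{k}$. If $k=k(n)\ge n^{1+\epsilon}$ for some $\epsilon>0$, then both $\frac{T_n(k)-\mathbb{E}T_n(k)}{n}$ and $\frac{T_n-\mathbb{E}T_n}{n}$ converge to zero a.s. as $n\to\infty$. (c) If the edge weights are uniformly square integrable in the sense that $\sup_{i\ge1}\mathbb{E}\left[t^2(q_i)\mathbf{1}(t(q_i)\ge M)\right]\longrightarrow0$ as $M\to\infty$, then $\mathrm{var}\left(\frac{T_n}{n}\right)\longrightarrow0$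 as $n\to\infty$. If $\sup_{i\ge1}\mathbb{E}t^p(q_i)<\infty$ for some $p>2$, then $\mathrm{var}(T_n)\le Cn$ for some constant $C>0$.
   Context: Two vertices $w_1=(w_{1,1},\ldots,w_{1,d})$ and $w_2=(w_{2,1},\ldots,w_{2,d})$ of $\mathbb{Z}^d$ are adjacent if $\sum_{i=1}^d|w_{1,i}-w_{2,i}|=1$, and adjacent vertices are joined by an edge. All passage times $t(q_i)$ are defined on a common probability space $(\Omega,\mathcal{F},\mathbb{P})$. A path $\pi$ is a finite sequence of distinct vertices $(w_1,\ldots,w_{r+1})$ with $w_i$ and $w_{i+1}$ adjacent for $1\le i\le r$; so paths are self-avoiding. If $e_i$ is the edge with endvertices $w_i$ and $w_{i+1}$, one writes $\pi=(e_1,\ldots,e_r)$; $w_1$ and $w_{r+1}$ are the endvertices of $\pi$, the length of $\pi$ is its number $r$ of edges, and its passage time is $T(\pi):=\sum_{i=1}^rt(e_i)$. Write $(n,\mathbf{0})$ for the vertex $(n,0,\ldots,0)\in\mathbb{Z}^d$. For $k\ge1$, the $k$-constrained minimum passage time between the origin and $(n,\mathbf{0})$ is $T_n(k):=\min_\pi T(\pi)$, the minimum over all paths $\pi$ of length at most $k$ with endvertices $(0,\mathbf{0})$ and $(n,\mathbf{0})$ (with the minimum over an empty set, which occurs when $k<n$, taken to be $+\infty$). The unconstrained minimum passage time is $T_n:=\inf_{k\ge1}T_n(k)$. $\mathrm{var}$ denotes variance and $\mathbf{1}(\cdot)$ denotes the indicator function of an event. *)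

theory Defs
  imports "HOL-Probability.Probability"
begin

text \<open>Vertices of the \<open>d\<close>-dimensional integer lattice: coordinates \<open>0, ..., d - 1\<close>; the remaining
  arguments are pinned to \<open>0\<close> so that distinct functions are distinct vertices.\<close>

definition lattice :: "nat \<Rightarrow> (nat \<Rightarrow> int) set" where
  "lattice d = {w. \<forall>i\<ge>d. w i = 0}"

definition adjacent :: "nat \<Rightarrow> (nat \<Rightarrow> int) \<Rightarrow> (nat \<Rightarrow> int) \<Rightarrow> bool" where
  "adjacent d u v \<longleftrightarrow> (\<Sum>i<d. \<bar>u i - v i\<bar>) = 1"

definition edges :: "nat \<Rightarrow> (nat \<Rightarrow> int) set set" where
  "edges d = {{u, v} | u v. u \<in> lattice d \<and> v \<in> lattice d \<and> adjacent d u v}"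

definition axis_point :: "nat \<Rightarrow> (nat \<Rightarrow> int)" where
  "axis_point n = (\<lambda>i. if i = 0 then int n else 0)"

text \<open>A path is given by its list of vertices, hence has one edge less than it has vertices.\<close>

definition is_path :: "nat \<Rightarrow> (nat \<Rightarrow> int) list \<Rightarrow> bool" where
  "is_path d ws \<longleftrightarrow> ws \<noteq> [] \<and> distinct ws \<and> set ws \<subseteq> lattice d \<and>
     (\<forall>i. Suc i < length ws \<longrightarrow> adjacent d (ws ! i) (ws ! Suc i))"

definition path_length :: "(nat \<Rightarrow> int) list \<Rightarrow> nat" where
  "path_length ws = length ws - 1"

definition passage_time :: "((nat \<Rightarrow> int) set \<Rightarrow> 'a \<Rightarrow> real) \<Rightarrow> (nat \<Rightarrow> int) list \<Rightarrow> 'a \<Rightarrow> real" where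
  "passage_time t ws \<omega> = (\<Sum>i<path_length ws. t {ws ! i, ws ! Suc i} \<omega>)"

definition paths_upto :: "nat \<Rightarrow> nat \<Rightarrow> nat \<Rightarrow> (nat \<Rightarrow> int) list set" where
  "paths_upto d n k =
     {ws. is_path d ws \<and> hd ws = axis_point 0 \<and> last ws = axis_point n \<and> path_length ws \<le> k}"

text \<open>The index set is finite, so the infimum is a minimum; it is \<open>\<infinity>\<close> when the set is empty,
  i.e. when \<open>k < n\<close>.\<close>

definition min_time_upto ::
  "nat \<Rightarrow> ((nat \<Rightarrow> int) set \<Rightarrow> 'a \<Rightarrow> real) \<Rightarrow> nat \<Rightarrow> nat \<Rightarrow> 'a \<Rightarrow> ereal" where
  "min_time_upto d t n k \<omega> = (INF ws\<in>paths_upto d n k. ereal (passage_time t ws \<omega>))"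

definition min_time :: "nat \<Rightarrow> ((nat \<Rightarrow> int) set \<Rightarrow> 'a \<Rightarrow> real) \<Rightarrow> nat \<Rightarrow> 'a \<Rightarrow> ereal" where
  "min_time d t n \<omega> = (INF k\<in>{1..}. min_time_upto d t n k \<omega>)"

text \<open>Mean and variance of an extended real random variable. Both are meaningful only for variables
  that are almost surely finite and square integrable; \<open>finite_second_moment\<close> expresses this.\<close>

definition finite_second_moment :: "'a measure \<Rightarrow> ('a \<Rightarrow> ereal) \<Rightarrow> bool" where
  "finite_second_moment M X \<longleftrightarrow> X \<in> borel_measurable M \<and> (AE \<omega> in M. \<bar>X \<omega>\<bar> \<noteq> \<infinity>) \<and>
     integrable M (\<lambda>\<omega>. (real_of_ereal (X \<omega>))\<^sup>2)"

definition mean :: "'a measure \<Rightarrow> ('a \<Rightarrow> ereal) \<Rightarrow> real" where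
  "mean M X = prob_space.expectation M (\<lambda>\<omega>. real_of_ereal (X \<omega>))"

definition var :: "'a measure \<Rightarrow> ('a \<Rightarrow> ereal) \<Rightarrow> real" where
  "var M X = prob_space.variance M (\<lambda>\<omega>. real_of_ereal (X \<omega>))"

end

theory Submission
  imports Defs "HOL-Library.Discrete_Functions"
begin

text \<open>
  The small-ball condition forces \<open>t > 0\<close> almost surely, so \<open>t\<close> may be replaced by \<open>\<bar>t\<bar>\<close>. A Chernoff bound and the
  count \<open>(2d)\<^sup>r\<close> of paths of length \<open>r\<close> from the origin give \<open>c > 0\<close> such that the probability of a path of length
  \<open>r\<close> with passage time at most \<open>c r\<close> is at most \<open>4\<^sup>-\<^sup>r\<close>; comparing with the straight path along the axis, whose
  passage time is controlled by Chebyshev's inequality, gives the linear bounds and the localisation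
  \<open>T\<^sub>n = T\<^sub>n(k)\<close>.

  For the variance, resampling a single edge increases \<open>T\<^sub>n(k)\<close> only if the edge lies on the minimising path \<open>\<pi>\<close>, and
  then by at most the new weight, which is independent of \<open>\<pi>\<close>. The Efron--Stein inequality therefore bounds the variance
  by \<open>\<mu>\<^sub>2\<close> times the mean length of \<open>\<pi>\<close>, and this length is at most \<open>T\<^sub>n(k) / c\<close> plus the lengths of the slow paths,
  hence \<open>O(n)\<close> in mean, uniformly in \<open>k\<close>. Letting \<open>k \<rightarrow> \<infinity>\<close> transfers the bound to \<open>T\<^sub>n\<close>, which also yields (c).
  The strong law follows along the squares from the variance bound, and in between from
  \<open>\<bar>T\<^sub>n - T\<^sub>m\<bar> \<le> \<Sum>\<^sub>m\<^sub>\<le>\<^sub>i\<^sub><\<^sub>n t\<^sub>i\<close>, where \<open>t\<^sub>i\<close> is the weight of the \<open>i\<close>-th edge of the axis.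
\<close>

section \<open>Lattice paths\<close>

text \<open>The one-sided form of the Efron--Stein inequality is what makes the variance argument
  work. Lowering the weight of an edge off the minimising path may reroute the minimum, and nothing
  bounds the number of such edges; raising it has no effect. Old and new weights are exchangeable,
  so the squared increases alone carry the whole variance, and the new weight enters only through
  its second moment. The remaining obstacle is the mean length of the minimiser, for which
  \<open>k\<close> is the only bound known in advance. A long minimiser is either paid for by its
  passage time or is an exceptionally cheap path, and exceptional paths of length \<open>r\<close>
  are so rare that their probabilities are summable even against the factor \<open>r\<close>.
  Efron--Stein is proved for bounded functions, which makes each integrability and Fubini condition
  immediate. The constrained minimum is therefore truncated at a level \<open>L\<close> first;
  \<open>L \<rightarrow> \<infinity>\<close> and \<open>k \<rightarrow> \<infinity>\<close> are both
  justified by domination by the square-integrable passage time of the straight path.\<close>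

definition paths :: "nat \<Rightarrow> nat \<Rightarrow> (nat \<Rightarrow> int) list set" where
  "paths d n = {ws. is_path d ws \<and> hd ws = axis_point 0 \<and> last ws = axis_point n}"

definition paths_of_length :: "nat \<Rightarrow> nat \<Rightarrow> (nat \<Rightarrow> int) list set" where
  "paths_of_length d r = {ws. is_path d ws \<and> hd ws = axis_point 0 \<and> path_length ws = r}"

definition path_edges :: "(nat \<Rightarrow> int) list \<Rightarrow> (nat \<Rightarrow> int) set set" where
  "path_edges ws = (\<lambda>i. {ws ! i, ws ! Suc i}) ` {..<path_length ws}"

definition axis_edge :: "nat \<Rightarrow> (nat \<Rightarrow> int) set" where
  "axis_edge i = {axis_point i, axis_point (Suc i)}"

definition straight :: "nat \<Rightarrow> (nat \<Rightarrow> int) list" where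
  "straight n = map axis_point [0..<Suc n]"

lemma paths_upto_eq: "paths_upto d n k = {ws \<in> paths d n. path_length ws \<le> k}"
  by (auto simp: paths_upto_def paths_def)

lemma is_path_snoc:
  assumes "ws \<noteq> []"
  shows "is_path d (ws @ [u]) \<longleftrightarrow>
    is_path d ws \<and> u \<in> lattice d \<and> u \<notin> set ws \<and> adjacent d (last ws) u"
proof -
  have "(\<forall>i. Suc i < length (ws @ [u]) \<longrightarrow> adjacent d ((ws @ [u]) ! i) ((ws @ [u]) ! Suc i)) \<longleftrightarrow>
      (\<forall>i. Suc i < length ws \<longrightarrow> adjacent d (ws ! i) (ws ! Suc i)) \<and> adjacent d (last ws) u"
    (is "(\<forall>i. ?P i) \<longleftrightarrow> ?Q \<and> ?R")
  proof
    assume P: "\<forall>i. ?P i"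
    have "?P (length ws - 1)" using P by blast
    then have ?R using assms by (simp add: nth_append last_conv_nth)
    moreover have ?Q
    proof (intro allI impI)
      fix i assume i: "Suc i < length ws"
      have "?P i" using P by blast
      then show "adjacent d (ws ! i) (ws ! Suc i)" using i by (simp add: nth_append)
    qed
    ultimately show "?Q \<and> ?R" by simp
  next
    assume QR: "?Q \<and> ?R"
    show "\<forall>i. ?P i"
    proof (intro allI impI)
      fix i assume "Suc i < length (ws @ [u])"
      then consider "Suc i < length ws" | "i = length ws - 1" "Suc i = length ws" by force
      then show "adjacent d ((ws @ [u]) ! i) ((ws @ [u]) ! Suc i)"
        using QR assms by cases (auto simp: nth_append last_conv_nth)
    qed
  qed
  then show ?thesis using assms by (auto simp: is_path_def)
qed

lemma is_path_take: "is_path d ws \<Longrightarrow> is_path d (take (Suc k) ws)"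
  using set_take_subset[of "Suc k" ws] by (auto simp: is_path_def)

lemma passage_time_snoc:
  assumes "ws \<noteq> []"
  shows "passage_time t (ws @ [u]) \<omega> = passage_time t ws \<omega> + t {last ws, u} \<omega>"
proof -
  obtain k where k: "length ws = Suc k" using assms by (cases ws) auto
  have "(\<Sum>i<k. t {(ws @ [u]) ! i, (ws @ [u]) ! Suc i} \<omega>) = (\<Sum>i<k. t {ws ! i, ws ! Suc i} \<omega>)"
    by (intro sum.cong refl) (simp add: nth_append k)
  then show ?thesis using assms
    by (simp add: passage_time_def path_length_def k nth_append last_conv_nth)
qed

lemma passage_time_take_le:
  assumes "\<And>e. 0 \<le> t e \<omega>" "k < length ws"
  shows "passage_time t (take (Suc k) ws) \<omega> \<le> passage_time t ws \<omega>"
proof -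
  have "passage_time t (take (Suc k) ws) \<omega> = (\<Sum>i<k. t {ws ! i, ws ! Suc i} \<omega>)"
    using assms(2) by (auto simp: passage_time_def path_length_def min_def intro!: sum.cong)
  also have "\<dots> \<le> (\<Sum>i<length ws - 1. t {ws ! i, ws ! Suc i} \<omega>)"
    using assms by (intro sum_mono2) auto
  finally show ?thesis by (simp add: passage_time_def path_length_def)
qed

text \<open>Equal edges at different indices would have crossed endpoints, \<open>i = Suc j\<close>
  and \<open>Suc i = j\<close>, which is impossible. Self-avoidance thus turns a passage time into a
  sum over a set of distinct edges, hence of independent weights.\<close>

lemma inj_on_path_edges:
  assumes "distinct ws"
  shows "inj_on (\<lambda>i. {ws ! i, ws ! Suc i}) {..<path_length ws}"
proof (rule inj_onI)
  fix i j assume "i \<in> {..<path_length ws}" "j \<in> {..<path_length ws}"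
    and eq: "{ws ! i, ws ! Suc i} = {ws ! j, ws ! Suc j}"
  then have "Suc i < length ws" "Suc j < length ws" by (auto simp: path_length_def)
  with eq assms show "i = j" by (auto simp: doubleton_eq_iff nth_eq_iff_index_eq)
qed

lemma finite_path_edges [simp]: "finite (path_edges ws)"
  by (simp add: path_edges_def)

lemma passage_time_eq_sum:
  "distinct ws \<Longrightarrow> passage_time t ws \<omega> = (\<Sum>e\<in>path_edges ws. t e \<omega>)"
  unfolding path_edges_def passage_time_def by (subst sum.reindex[OF inj_on_path_edges]) auto

lemma card_path_edges: "distinct ws \<Longrightarrow> card (path_edges ws) = path_length ws"
  unfolding path_edges_def by (simp add: card_image[OF inj_on_path_edges])

lemma path_edges_subset: "is_path d ws \<Longrightarrow> path_edges ws \<subseteq> edges d"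
proof
  fix e assume p: "is_path d ws" and "e \<in> path_edges ws"
  then obtain i where e: "e = {ws ! i, ws ! Suc i}" and i: "Suc i < length ws"
    by (auto simp: path_edges_def path_length_def)
  then have "ws ! i \<in> set ws" "ws ! Suc i \<in> set ws" by auto
  with p i have "ws ! i \<in> lattice d" "ws ! Suc i \<in> lattice d" "adjacent d (ws ! i) (ws ! Suc i)"
    by (auto simp: is_path_def)
  then show "e \<in> edges d" unfolding edges_def e by blast
qed

section \<open>Counting neighbours and paths\<close>

text \<open>The coordinate differences are integers whose absolute values sum to 1, so one differing
  coordinate uses up the whole sum and all others agree. Coordinates from \<open>d\<close> on agree
  because both points lie in \<open>lattice d\<close>.\<close>

lemma neighbours_subset:
  assumes v: "v \<in> lattice d"
  shows "{u \<in> lattice d. adjacent d v u} \<subseteq> (\<lambda>(i, s). v(i := v i + s)) ` ({..<d} \<times> {1, -1})"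
proof
  fix u assume "u \<in> {u \<in> lattice d. adjacent d v u}"
  then have u: "u \<in> lattice d" and s: "(\<Sum>i<d. \<bar>v i - u i\<bar>) = 1" by (auto simp: adjacent_def)
  have "\<exists>i<d. v i \<noteq> u i"
  proof (rule ccontr)
    assume "\<not> ?thesis"
    then have "(\<Sum>i<d. \<bar>v i - u i\<bar>) = 0" by (intro sum.neutral) auto
    with s show False by simp
  qed
  then obtain i where i: "i < d" "v i \<noteq> u i" by blast
  have split: "(\<Sum>i<d. \<bar>v i - u i\<bar>) = \<bar>v i - u i\<bar> + (\<Sum>j\<in>{..<d} - {i}. \<bar>v j - u j\<bar>)"
    using i by (intro sum.remove) auto
  have nn: "0 \<le> (\<Sum>j\<in>{..<d} - {i}. \<bar>v j - u j\<bar>)" by (intro sum_nonneg) auto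
  with split s i have 1: "\<bar>v i - u i\<bar> = 1" and "(\<Sum>j\<in>{..<d} - {i}. \<bar>v j - u j\<bar>) = 0" by linarith+
  then have 0: "\<forall>j\<in>{..<d} - {i}. v j = u j" by (subst (asm) sum_nonneg_eq_0_iff) auto
  have "u = v(i := v i + (u i - v i))"
  proof
    fix j show "u j = (v(i := v i + (u i - v i))) j"
      using 0 u v by (cases "j < d") (auto simp: lattice_def)
  qed
  moreover have "u i - v i \<in> {1, -1}" using 1 by auto
  ultimately show "u \<in> (\<lambda>(i, s). v(i := v i + s)) ` ({..<d} \<times> {1, -1})"
    using i by (intro image_eqI[where x = "(i, u i - v i)"]) auto
qed

lemma neighbours:
  assumes "v \<in> lattice d"
  shows "finite {u \<in> lattice d. adjacent d v u}" "card {u \<in> lattice d. adjacent d v u} \<le> 2 * d"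
proof -
  note sub = neighbours_subset[OF assms]
  show "finite {u \<in> lattice d. adjacent d v u}" by (rule finite_subset[OF sub]) auto
  have "card {u \<in> lattice d. adjacent d v u} \<le> card ({..<d} \<times> {1, -1::int})"
    by (rule order_trans[OF card_mono[OF _ sub] card_image_le]) auto
  then show "card {u \<in> lattice d. adjacent d v u} \<le> 2 * d" by (simp add: card_cartesian_product)
qed

lemma axis_point_lattice: "d \<ge> 1 \<Longrightarrow> axis_point n \<in> lattice d"
  by (auto simp: lattice_def axis_point_def)

text \<open>Removing the last vertex leaves a path of length \<open>r\<close> whose end has at most
  \<open>2 * d\<close> neighbours; the free endpoint keeps this within the family. The crude count
  suffices, because the Laplace transform of a single weight can be made as small as
  desired.\<close>

lemma paths_of_length:
  assumes "d \<ge> 1"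
  shows "finite (paths_of_length d r) \<and> card (paths_of_length d r) \<le> (2 * d) ^ r"
proof (induction r)
  case 0
  have "paths_of_length d 0 \<subseteq> {[axis_point 0]}"
  proof
    fix ws assume "ws \<in> paths_of_length d 0"
    then show "ws \<in> {[axis_point 0]}"
      by (cases ws) (auto simp: paths_of_length_def path_length_def is_path_def)
  qed
  then show ?case using card_mono[of "{[axis_point 0]}"] by (auto intro: finite_subset)
next
  case (Suc r)
  let ?S = "SIGMA ws:paths_of_length d r. {u \<in> lattice d. adjacent d (last ws) u}"
  have lat: "last ws \<in> lattice d" if "ws \<in> paths_of_length d r" for ws
    using that by (auto simp: paths_of_length_def is_path_def)
  have sub: "paths_of_length d (Suc r) \<subseteq> (\<lambda>(ws, u). ws @ [u]) ` ?S"
  proof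
    fix vs assume vs: "vs \<in> paths_of_length d (Suc r)"
    then have "length vs = Suc (Suc r)" by (cases vs) (auto simp: paths_of_length_def path_length_def is_path_def)
    then obtain ws u where vsu: "vs = ws @ [u]" and ne: "ws \<noteq> []"
      by (metis append_butlast_last_id length_butlast length_0_conv diff_Suc_1 nat.distinct(1))
    with vs have "ws \<in> paths_of_length d r" "u \<in> lattice d" "adjacent d (last ws) u"
      by (auto simp: paths_of_length_def is_path_snoc path_length_def)
    then show "vs \<in> (\<lambda>(ws, u). ws @ [u]) ` ?S" using vsu by (intro image_eqI[where x = "(ws, u)"]) auto
  qed
  have fin: "finite ?S" using Suc lat neighbours(1) by (intro finite_SigmaI) auto
  have "card (paths_of_length d (Suc r)) \<le> card ?S"
    by (rule order_trans[OF card_mono[OF _ sub] card_image_le]) (use fin in auto)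
  also have "\<dots> = (\<Sum>ws\<in>paths_of_length d r. card {u \<in> lattice d. adjacent d (last ws) u})"
    using Suc lat neighbours(1) by (intro card_SigmaI) auto
  also have "\<dots> \<le> (\<Sum>ws\<in>paths_of_length d r. 2 * d)"
    using lat neighbours(2) by (intro sum_mono) auto
  also have "\<dots> \<le> (2 * d) ^ Suc r" using Suc by simp
  finally show ?case using finite_subset[OF sub] fin by auto
qed

text \<open>One step changes the first coordinate by at most 1. A path to
  \<open>axis_point n\<close> therefore has at least \<open>n\<close> edges.\<close>

lemma is_path_first_coordinate:
  assumes "d \<ge> 1" "is_path d ws" "i < length ws"
  shows "\<bar>(ws ! i) 0 - (ws ! 0) 0\<bar> \<le> int i"
  using assms(3)
proof (induction i)
  case (Suc i)
  then have "adjacent d (ws ! i) (ws ! Suc i)" using assms(2) by (auto simp: is_path_def)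
  moreover have "\<bar>(ws ! i) 0 - (ws ! Suc i) 0\<bar> \<le> (\<Sum>j<d. \<bar>(ws ! i) j - (ws ! Suc i) j\<bar>)"
    using assms(1) by (intro member_le_sum) auto
  ultimately have "\<bar>(ws ! i) 0 - (ws ! Suc i) 0\<bar> \<le> 1" by (simp add: adjacent_def)
  with Suc show ?case by auto
qed simp

lemma path_length_ge:
  assumes "d \<ge> 1" "ws \<in> paths d n"
  shows "n \<le> path_length ws"
proof -
  have "ws \<noteq> []" using assms(2) by (auto simp: paths_def is_path_def)
  then show ?thesis
    using is_path_first_coordinate[of d ws "length ws - 1"] assms
    by (auto simp: paths_def path_length_def hd_conv_nth last_conv_nth axis_point_def)
qed

section \<open>The axis, the straight path and the families of paths to a point of the axis\<close>

lemma adjacent_axis: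
  assumes "d \<ge> 1"
  shows "adjacent d (axis_point n) (axis_point (Suc n))" "adjacent d (axis_point (Suc n)) (axis_point n)"
proof -
  have "\<bar>axis_point n i - axis_point (Suc n) i\<bar> = (if i = 0 then 1 else 0)"
    "\<bar>axis_point (Suc n) i - axis_point n i\<bar> = (if i = 0 then 1 else 0)" for i
    by (auto simp: axis_point_def)
  then show "adjacent d (axis_point n) (axis_point (Suc n))" "adjacent d (axis_point (Suc n)) (axis_point n)"
    using assms by (simp_all add: adjacent_def sum.delta)
qed

lemma axis_edge_edges: "d \<ge> 1 \<Longrightarrow> axis_edge i \<in> edges d"
  unfolding axis_edge_def edges_def using adjacent_axis axis_point_lattice by blast

lemma axis_point_eq_iff [simp]: "axis_point m = axis_point n \<longleftrightarrow> m = n"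
  by (metis axis_point_def of_nat_eq_iff)

lemma inj_axis_point: "inj axis_point"
  by (simp add: inj_def)

text \<open>Different indices give different edges, so the weights along the axis are
  independent.\<close>

lemma inj_axis_edge: "inj axis_edge"
  by (auto simp: inj_def axis_edge_def doubleton_eq_iff)

lemma straight_nth: "i \<le> n \<Longrightarrow> straight n ! i = axis_point i"
  unfolding straight_def by (simp del: upt_Suc)

lemma path_length_straight [simp]: "path_length (straight n) = n"
  by (simp add: path_length_def straight_def)

lemma straight_in_paths_upto:
  assumes "d \<ge> 1" "n \<le> k"
  shows "straight n \<in> paths_upto d n k"
proof -
  have len: "length (straight n) = Suc n" by (simp add: straight_def)
  have "set (straight n) \<subseteq> lattice d" using axis_point_lattice[OF assms(1)] by (auto simp: straight_def)
  moreover have "distinct (straight n)"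
    by (simp add: straight_def distinct_map inj_on_subset[OF inj_axis_point] del: upt_Suc)
  moreover have "straight n \<noteq> []" using len by auto
  ultimately show ?thesis
    using assms adjacent_axis[OF assms(1)] len
    by (auto simp: paths_upto_def is_path_def straight_nth hd_conv_nth last_conv_nth)
qed

lemma passage_time_straight: "passage_time t (straight n) \<omega> = (\<Sum>i<n. t (axis_edge i) \<omega>)"
  by (auto simp: passage_time_def straight_nth axis_edge_def intro!: sum.cong)

text \<open>Appending the new vertex may destroy self-avoidance. If the target has been visited
  before, the path is cut there instead, and nonnegative weights make the cut path no more
  expensive.\<close>

lemma paths_extend:
  assumes d: "d \<ge> 1" and ws: "ws \<in> paths d n" and adj: "adjacent d (axis_point n) (axis_point m)"
    and nn: "\<And>e. 0 \<le> t e \<omega>"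
  shows "\<exists>vs\<in>paths d m. passage_time t vs \<omega> \<le> passage_time t ws \<omega> + t {axis_point n, axis_point m} \<omega>"
proof (cases "axis_point m \<in> set ws")
  case True
  then obtain i where i: "i < length ws" "ws ! i = axis_point m" by (auto simp: in_set_conv_nth)
  then have "take (Suc i) ws \<in> paths d m"
    using ws is_path_take[of d ws i] by (auto simp: paths_def take_Suc_conv_app_nth[OF i(1)] hd_append hd_conv_nth)
  moreover have "passage_time t (take (Suc i) ws) \<omega> \<le> passage_time t ws \<omega> + t {axis_point n, axis_point m} \<omega>"
    using passage_time_take_le[of t \<omega> i ws, OF nn i(1)] nn[of "{axis_point n, axis_point m}"] by linarith
  ultimately show ?thesis by blast
next
  case False
  have ne: "ws \<noteq> []" using ws by (auto simp: paths_def is_path_def)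
  with False ws adj have "ws @ [axis_point m] \<in> paths d m"
    by (auto simp: paths_def is_path_snoc axis_point_lattice[OF d])
  moreover have "last ws = axis_point n" using ws by (simp add: paths_def)
  ultimately show ?thesis using passage_time_snoc[OF ne, of t "axis_point m" \<omega>] by force
qed

lemma finite_paths_upto:
  assumes "d \<ge> 1"
  shows "finite (paths_upto d n k)"
proof (rule finite_subset)
  show "paths_upto d n k \<subseteq> (\<Union>r\<le>k. paths_of_length d r)"
    by (auto simp: paths_upto_def paths_of_length_def)
qed (use paths_of_length[OF assms] in auto)

text \<open>Countability makes the infimum over all paths measurable.\<close>

lemma countable_paths:
  assumes "d \<ge> 1"
  shows "countable (paths d n)"
proof (rule countable_subset)
  show "paths d n \<subseteq> (\<Union>r. paths_of_length d r)"
    by (auto simp: paths_def paths_of_length_def)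
qed (use paths_of_length[OF assms] countable_finite in blast)

section \<open>Variance inequalities\<close>

lemma (in prob_space) integrable_bounded:
  fixes f :: "'a \<Rightarrow> real"
  assumes "f \<in> borel_measurable M" "\<And>x. \<bar>f x\<bar> \<le> L"
  shows "integrable M f"
  using assms by (intro integrable_const_bound[where B = L]) auto

text \<open>A non-integrable function has integral 0 by convention, and a bound on an absolute value
  forces \<open>0 \<le> L\<close>, so that case is covered as well.\<close>

lemma (in prob_space) abs_expectation_le:
  fixes f :: "'a \<Rightarrow> real"
  assumes bd: "\<And>x. \<bar>f x\<bar> \<le> L"
  shows "\<bar>expectation f\<bar> \<le> L"
proof (cases "integrable M f")
  case True
  have "expectation f \<le> L" by (rule integral_le_const[OF True]) (use bd in \<open>auto simp: abs_le_iff\<close>)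
  moreover have "- L \<le> expectation f"
    by (rule integral_ge_const[OF True]) (use bd in \<open>simp add: abs_le_iff minus_le_iff\<close>)
  ultimately show ?thesis by simp
next
  case False
  then show ?thesis using bd[of undefined] by (simp add: not_integrable_integral_eq)
qed

text \<open>The variance is half the mean of \<open>(f y - f x)\<^sup>2\<close> over two independent
  copies. Exchanging the copies shows that the positive and the negative part of the difference
  contribute equally, so the positive part alone accounts for the variance.\<close>

lemma (in prob_space) variance_le_positive_parts:
  fixes f :: "'a \<Rightarrow> real"
  assumes [measurable]: "f \<in> borel_measurable M" and bd: "\<And>x. \<bar>f x\<bar> \<le> L"
  shows "(\<integral>x. (f x)\<^sup>2 \<partial>M) - (\<integral>x. f x \<partial>M)\<^sup>2 \<le> (\<integral>x. (\<integral>y. (max 0 (f y - f x))\<^sup>2 \<partial>M) \<partial>M)"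
proof -
  interpret P: pair_prob_space M M ..
  have i1: "integrable M f" by (rule integrable_bounded[OF _ bd]) simp
  have i2: "integrable M (\<lambda>x. (f x)\<^sup>2)"
    by (rule integrable_bounded[where L = "L\<^sup>2"]) (use bd in \<open>auto simp: abs_le_square_iff[symmetric] intro: order_trans[OF bd]\<close>)
  define m where "m = (\<lambda>x y. (max 0 (f y - f x))\<^sup>2)"
  have diff: "\<bar>f y - f x\<bar> \<le> 2 * L" for x y using bd[of x] bd[of y] by linarith
  have mb: "\<bar>m x y\<bar> \<le> (2 * L)\<^sup>2" for x y
    using diff[of y x] power_mono[of "max 0 (f y - f x)" "2 * L" 2] by (auto simp: m_def)
  have m_meas[measurable]: "(\<lambda>p. m (fst p) (snd p)) \<in> borel_measurable (M \<Otimes>\<^sub>M M)"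
    unfolding m_def by measurable
  have mi: "integrable (M \<Otimes>\<^sub>M M) (\<lambda>(x, y). m x y)"
    by (rule P.P.integrable_bounded[where L = "(2 * L)\<^sup>2"]) (use mb in \<open>auto simp: split_beta simp del: power_mult_distrib\<close>)
  have mi2: "integrable M (\<lambda>y. m x y)" "integrable M (\<lambda>y. m y x)" for x
    by (rule integrable_bounded[OF _ mb]; simp add: m_def)+
  have swap: "(\<integral>x. (\<integral>y. m y x \<partial>M) \<partial>M) = (\<integral>x. (\<integral>y. m x y \<partial>M) \<partial>M)"
    using P.Fubini_integral[OF mi] by simp
  have "(\<integral>x. (\<integral>y. (f y - f x)\<^sup>2 \<partial>M) \<partial>M) = (\<integral>x. (\<integral>y. m x y + m y x \<partial>M) \<partial>M)"
    by (intro Bochner_Integration.integral_cong refl) (auto simp: m_def max_def power2_eq_square algebra_simps)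
  also have "\<dots> = (\<integral>x. (\<integral>y. m x y \<partial>M) + (\<integral>y. m y x \<partial>M) \<partial>M)"
    using mi2 by simp
  also have "\<dots> = (\<integral>x. (\<integral>y. m x y \<partial>M) \<partial>M) + (\<integral>x. (\<integral>y. m y x \<partial>M) \<partial>M)"
    using P.integrable_fst[OF mi] P.integrable_snd[OF mi] by (intro Bochner_Integration.integral_add) auto
  finally have 1: "(\<integral>x. (\<integral>y. (f y - f x)\<^sup>2 \<partial>M) \<partial>M) = 2 * (\<integral>x. (\<integral>y. m x y \<partial>M) \<partial>M)"
    using swap by simp
  have "(\<integral>y. (f y - f x)\<^sup>2 \<partial>M) = expectation (\<lambda>y. (f y)\<^sup>2) + (f x)\<^sup>2 - 2 * f x * expectation f" for x
    using i1 i2 by (simp add: power2_diff prob_space algebra_simps)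
  then have "(\<integral>x. (\<integral>y. (f y - f x)\<^sup>2 \<partial>M) \<partial>M)
      = (\<integral>x. expectation (\<lambda>y. (f y)\<^sup>2) + (f x)\<^sup>2 - 2 * f x * expectation f \<partial>M)" by simp
  also have "\<dots> = 2 * (expectation (\<lambda>y. (f y)\<^sup>2) - (expectation f)\<^sup>2)"
    using i1 i2 by (simp add: prob_space power2_eq_square)
  finally show ?thesis using 1 by (simp add: m_def)
qed

text \<open>With \<open>g\<close> and \<open>h\<close> the partial means and \<open>m\<close> the
  total mean, the interaction term \<open>F x y - g y - h x + m\<close> of the Hoeffding
  decomposition has nonnegative mean square. Expanded, this says that the second moments of
  \<open>g\<close> and \<open>h\<close> add up to at most that of \<open>F\<close> plus
  \<open>m\<^sup>2\<close>, and the claim is a rearrangement of it.\<close>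

lemma (in pair_prob_space) variance_le_sum_variances:
  fixes F :: "'a \<Rightarrow> 'b \<Rightarrow> real"
  assumes F[measurable]: "(\<lambda>(x, y). F x y) \<in> borel_measurable (M1 \<Otimes>\<^sub>M M2)"
    and bd: "\<And>x y. \<bar>F x y\<bar> \<le> L"
  shows "(\<integral>x. (\<integral>y. (F x y)\<^sup>2 \<partial>M2) \<partial>M1) - (\<integral>x. (\<integral>y. F x y \<partial>M2) \<partial>M1)\<^sup>2
     \<le> (\<integral>y. (\<integral>x. (F x y)\<^sup>2 \<partial>M1) - (\<integral>x. F x y \<partial>M1)\<^sup>2 \<partial>M2)
      + (\<integral>x. (\<integral>y. (F x y)\<^sup>2 \<partial>M2) - (\<integral>y. F x y \<partial>M2)\<^sup>2 \<partial>M1)"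
proof -
  have L0: "0 \<le> L" using bd[of undefined undefined] by linarith
  have bd2: "\<bar>(F x y)\<^sup>2\<bar> \<le> L\<^sup>2" for x y
    using bd[of x y] by (simp add: abs_le_square_iff[symmetric])
  define h where "h = (\<lambda>x. \<integral>y. F x y \<partial>M2)"
  define g where "g = (\<lambda>y. \<integral>x. F x y \<partial>M1)"
  define m where "m = (\<integral>x. h x \<partial>M1)"
  have hb: "\<bar>h x\<bar> \<le> L" for x
    unfolding h_def by (rule M2.abs_expectation_le[OF bd])
  have gb: "\<bar>g y\<bar> \<le> L" for y
    unfolding g_def by (rule M1.abs_expectation_le[OF bd])
  have [measurable]: "h \<in> borel_measurable M1" "g \<in> borel_measurable M2"
    unfolding h_def g_def by measurable
  note ib = P.integrable_bounded
  have iF: "integrable (M1 \<Otimes>\<^sub>M M2) (\<lambda>(x, y). F x y)"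
    by (rule ib[where L = L]) (use bd in \<open>auto simp: split_beta\<close>)
  have iF2: "integrable (M1 \<Otimes>\<^sub>M M2) (\<lambda>(x, y). (F x y)\<^sup>2)"
    by (rule ib[where L = "L\<^sup>2"]) (use bd2 in \<open>auto simp: split_beta\<close>)
  have prod_bd: "\<bar>a * b\<bar> \<le> L\<^sup>2" if "\<bar>a\<bar> \<le> L" "\<bar>b\<bar> \<le> L" for a b
    using mult_mono[OF that] L0 by (simp add: abs_mult power2_eq_square)
  have iFx: "integrable M2 (F x)" if "x \<in> space M1" for x
    by (rule M2.integrable_bounded[where L = L]) (use bd that in auto)
  have iFx2: "integrable M2 (\<lambda>y. (F x y)\<^sup>2)" if "x \<in> space M1" for x
    by (rule M2.integrable_bounded[where L = "L\<^sup>2"]) (use bd2 that in auto)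
  have iFy: "integrable M1 (\<lambda>x. F x y)" if "y \<in> space M2" for y
    by (rule M1.integrable_bounded[where L = L]) (use bd that in auto)
  have ig: "integrable M2 g" by (rule M2.integrable_bounded[OF _ gb]) simp
  have ih: "integrable M1 h" by (rule M1.integrable_bounded[OF _ hb]) simp
  have ig2: "integrable M2 (\<lambda>y. (g y)\<^sup>2)"
    unfolding power2_eq_square by (rule M2.integrable_bounded[OF _ prod_bd[OF gb gb]]) simp
  have ih2: "integrable M1 (\<lambda>y. (h y)\<^sup>2)"
    unfolding power2_eq_square by (rule M1.integrable_bounded[OF _ prod_bd[OF hb hb]]) simp
  have iFg: "integrable (M1 \<Otimes>\<^sub>M M2) (\<lambda>(x, y). F x y * g y)"
    by (rule ib[where L = "L\<^sup>2"]) (use prod_bd gb bd in \<open>auto simp: split_beta\<close>)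
  have iFgx: "integrable M2 (\<lambda>y. F x y * g y)" if "x \<in> space M1" for x
    by (rule M2.integrable_bounded[where L = "L\<^sup>2"]) (use prod_bd gb bd that in auto)
  define A where "A = (\<integral>x. (\<integral>y. (F x y)\<^sup>2 \<partial>M2) \<partial>M1)"
  have A': "(\<integral>y. (\<integral>x. (F x y)\<^sup>2 \<partial>M1) \<partial>M2) = A"
    unfolding A_def by (rule Fubini_integral[OF iF2])
  have m': "(\<integral>y. g y \<partial>M2) = m"
    unfolding m_def g_def h_def by (rule Fubini_integral[OF iF])
  \<comment> \<open>Integrating out \<open>x\<close> first turns the mixed term into the second
    moment of \<open>g\<close>.\<close>
  have Fg: "(\<integral>x. (\<integral>y. F x y * g y \<partial>M2) \<partial>M1) = (\<integral>y. (g y)\<^sup>2 \<partial>M2)"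
    by (subst Fubini_integral[OF iFg, symmetric]) (simp add: g_def power2_eq_square)
  have "0 \<le> (\<integral>x. (\<integral>y. (F x y - g y - h x + m)\<^sup>2 \<partial>M2) \<partial>M1)" by simp
  also have "\<dots> = (\<integral>x. (\<integral>y. (F x y)\<^sup>2 \<partial>M2) - 2 * (\<integral>y. F x y * g y \<partial>M2) + (\<integral>y. (g y)\<^sup>2 \<partial>M2) - (h x)\<^sup>2
      + 2 * m * h x - m\<^sup>2 \<partial>M1)"
  proof (intro Bochner_Integration.integral_cong refl)
    fix x assume x: "x \<in> space M1"
    note i = iFx2[OF x] iFx[OF x] iFgx[OF x] ig ig2
    have "(\<integral>y. (F x y - g y - h x + m)\<^sup>2 \<partial>M2) = (\<integral>y. (F x y)\<^sup>2 - 2 * (F x y * g y) + (g y)\<^sup>2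
        + (2 * m - 2 * h x) * F x y - (2 * m - 2 * h x) * g y + (m - h x)\<^sup>2 \<partial>M2)"
      by (intro Bochner_Integration.integral_cong refl) (simp add: power2_eq_square algebra_simps)
    also have "\<dots> = (\<integral>y. (F x y)\<^sup>2 \<partial>M2) - 2 * (\<integral>y. F x y * g y \<partial>M2) + (\<integral>y. (g y)\<^sup>2 \<partial>M2)
        + (2 * m - 2 * h x) * h x - (2 * m - 2 * h x) * m + (m - h x)\<^sup>2"
      using i by (simp add: M2.prob_space m', simp add: h_def)
    finally show "(\<integral>y. (F x y - g y - h x + m)\<^sup>2 \<partial>M2) = (\<integral>y. (F x y)\<^sup>2 \<partial>M2) - 2 * (\<integral>y. F x y * g y \<partial>M2)
        + (\<integral>y. (g y)\<^sup>2 \<partial>M2) - (h x)\<^sup>2 + 2 * m * h x - m\<^sup>2"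
      by (simp add: power2_eq_square algebra_simps)
  qed
  also have "\<dots> = A - (\<integral>y. (g y)\<^sup>2 \<partial>M2) - (\<integral>x. (h x)\<^sup>2 \<partial>M1) + m\<^sup>2"
    using integrable_fst[OF iF2] integrable_fst[OF iFg] ih ih2
    by (simp add: A_def Fg M1.prob_space m_def[symmetric] power2_eq_square)
  finally have "(\<integral>y. (g y)\<^sup>2 \<partial>M2) + (\<integral>x. (h x)\<^sup>2 \<partial>M1) \<le> A + m\<^sup>2" by simp
  moreover have "(\<integral>y. (\<integral>x. (F x y)\<^sup>2 \<partial>M1) - (g y)\<^sup>2 \<partial>M2) = A - (\<integral>y. (g y)\<^sup>2 \<partial>M2)"
    using integrable_snd[OF iF2] ig2 by (simp add: A')
  moreover have "(\<integral>x. (\<integral>y. (F x y)\<^sup>2 \<partial>M2) - (h x)\<^sup>2 \<partial>M1) = A - (\<integral>x. (h x)\<^sup>2 \<partial>M1)"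
    using integrable_fst[OF iF2] ih2 by (simp add: A_def)
  ultimately show ?thesis
    unfolding A_def m_def g_def h_def by linarith
qed

lemma measurable_resampled_variation:
  fixes f :: "('i \<Rightarrow> 'b) \<Rightarrow> real"
  assumes N: "\<And>i. prob_space (N i)" and [measurable]: "f \<in> borel_measurable (PiM I N)" and "i \<in> I"
  shows "(\<lambda>x. \<integral>y. (max 0 (f (x(i := y)) - f x))\<^sup>2 \<partial>N i) \<in> borel_measurable (PiM I N)"
proof -
  interpret Ni: prob_space "N i" by (rule N)
  have "(\<lambda>(x, y). x(i := y)) \<in> measurable (PiM I N \<Otimes>\<^sub>M N i) (PiM (insert i I) N)"
    by (rule measurable_add_dim)
  then have [measurable]: "(\<lambda>(x, y). x(i := y)) \<in> measurable (PiM I N \<Otimes>\<^sub>M N i) (PiM I N)"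
    by (simp only: insert_absorb[OF \<open>i \<in> I\<close>])
  show ?thesis by measurable
qed

text \<open>Induction on the index set. When a coordinate \<open>j\<close> is split off, the
  two-factor inequality leaves the mean variance in the old coordinates with the new one frozen,
  where the induction hypothesis applies, and the mean variance in \<open>j\<close> with the old
  ones frozen, which is the one-variable case.\<close>

theorem efron_stein:
  fixes f :: "('i \<Rightarrow> 'b) \<Rightarrow> real"
  assumes N: "\<And>i. prob_space (N i)" and "finite I"
    and f: "f \<in> borel_measurable (PiM I N)" and bd: "\<And>x. \<bar>f x\<bar> \<le> L"
  shows "(\<integral>x. (f x)\<^sup>2 \<partial>PiM I N) - (\<integral>x. f x \<partial>PiM I N)\<^sup>2
    \<le> (\<Sum>i\<in>I. \<integral>x. (\<integral>y. (max 0 (f (x(i := y)) - f x))\<^sup>2 \<partial>N i) \<partial>PiM I N)"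
  using \<open>finite I\<close> f bd
proof (induction I arbitrary: f rule: finite_induct)
  case empty
  show ?case by (simp add: PiM_empty lebesgue_integral_count_space_finite)
next
  case (insert j I)
  note [measurable] = insert.prems(1) and bd = insert.prems(2)
  interpret P: prob_space "PiM I N" by (rule prob_space_PiM[OF N])
  interpret Q: prob_space "N j" by (rule N)
  interpret R: prob_space "PiM (insert j I) N" by (rule prob_space_PiM[OF N])
  interpret NN: product_prob_space N I
    by (intro product_prob_space.intro product_prob_space_axioms.intro product_sigma_finite.intro
          prob_space_imp_sigma_finite N)
  interpret PQ: pair_prob_space "PiM I N" "N j" ..
  have upd[measurable]: "(\<lambda>(x, y). x(j := y)) \<in> measurable (PiM I N \<Otimes>\<^sub>M N j) (PiM (insert j I) N)"
    by (rule measurable_add_dim)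
  have sq: "\<bar>a\<^sup>2\<bar> \<le> L\<^sup>2" if "\<bar>a\<bar> \<le> L" for a
    using that by (simp add: abs_le_square_iff[symmetric])
  have dsq: "\<bar>(max 0 (f y - f x))\<^sup>2\<bar> \<le> (2 * L)\<^sup>2" for x y
    using bd[of x] bd[of y] power_mono[of "max 0 (f y - f x)" "2 * L" 2]
    by (simp del: power_mult_distrib)
  have fold: "(\<integral>x. g x \<partial>PiM (insert j I) N) = (\<integral>x. (\<integral>y. g (x(j := y)) \<partial>N j) \<partial>PiM I N)"
    if "g \<in> borel_measurable (PiM (insert j I) N)" "\<And>x. \<bar>g x\<bar> \<le> B" for g :: "_ \<Rightarrow> real" and B
    by (rule NN.product_integral_insert[OF insert.hyps R.integrable_bounded[OF that]])
  \<comment> \<open>Two orders of integration are needed: \<open>fold\<close> for the term in which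
    the old coordinates are frozen, \<open>fold'\<close> for the term in which the new one
    is.\<close>
  have fold': "(\<integral>x. g x \<partial>PiM (insert j I) N) = (\<integral>y. (\<integral>x. g (x(j := y)) \<partial>PiM I N) \<partial>N j)"
    if [measurable]: "g \<in> borel_measurable (PiM (insert j I) N)" and "\<And>x. \<bar>g x\<bar> \<le> B"
    for g :: "_ \<Rightarrow> real" and B
  proof -
    have "integrable (PiM I N \<Otimes>\<^sub>M N j) (\<lambda>(x, y). g (x(j := y)))"
      by (rule PQ.P.integrable_bounded[where L = B]) (use that(2) in \<open>auto simp: split_beta\<close>)
    from PQ.Fubini_integral[OF this] show ?thesis
      using fold[OF that] by simp
  qed
  define F where "F = (\<lambda>x y. f (x(j := y)))"
  have F[measurable]: "(\<lambda>(x, y). F x y) \<in> borel_measurable (PiM I N \<Otimes>\<^sub>M N j)"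
    unfolding F_def by measurable
  define D where "D = (\<lambda>i x. \<integral>y. (max 0 (f (x(i := y)) - f x))\<^sup>2 \<partial>N i)"
  have Db: "\<bar>D i x\<bar> \<le> (2 * L)\<^sup>2" for i x
    unfolding D_def by (rule prob_space.abs_expectation_le[OF N dsq])
  have Dm[measurable]: "D i \<in> borel_measurable (PiM (insert j I) N)" if "i \<in> insert j I" for i
    unfolding D_def by (rule measurable_resampled_variation[OF N insert.prems(1) that])
  \<comment> \<open>Resampling an old coordinate commutes with fixing the new one, so the variation
    of a section of \<open>f\<close> is the section of the variation.\<close>
  have DI: "D i (x(j := y)) = (\<integral>z. (max 0 (f ((x(i := z))(j := y)) - f (x(j := y))))\<^sup>2 \<partial>N i)"
    if "i \<in> I" for i x y
  proof -
    have "i \<noteq> j" using that insert.hyps by auto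
    then show ?thesis by (simp add: D_def fun_upd_twist)
  qed
  have DJ: "D j (x(j := y)) = (\<integral>z. (max 0 (F x z - F x y))\<^sup>2 \<partial>N j)" for x y
    by (simp add: D_def F_def)
  have "(\<integral>x. (f x)\<^sup>2 \<partial>PiM (insert j I) N) - (\<integral>x. f x \<partial>PiM (insert j I) N)\<^sup>2
     = (\<integral>x. (\<integral>y. (F x y)\<^sup>2 \<partial>N j) \<partial>PiM I N) - (\<integral>x. (\<integral>y. F x y \<partial>N j) \<partial>PiM I N)\<^sup>2"
    using fold[of f L, OF _ bd] fold[of "\<lambda>x. (f x)\<^sup>2" "L\<^sup>2", OF _ sq[OF bd]] by (simp only: F_def insert.prems(1)) simp
  also have "\<dots> \<le> (\<integral>y. (\<integral>x. (F x y)\<^sup>2 \<partial>PiM I N) - (\<integral>x. F x y \<partial>PiM I N)\<^sup>2 \<partial>N j)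
      + (\<integral>x. (\<integral>y. (F x y)\<^sup>2 \<partial>N j) - (\<integral>y. F x y \<partial>N j)\<^sup>2 \<partial>PiM I N)"
    by (rule PQ.variance_le_sum_variances[OF F, where L = L]) (simp add: F_def bd)
  also have "(\<integral>y. (\<integral>x. (F x y)\<^sup>2 \<partial>PiM I N) - (\<integral>x. F x y \<partial>PiM I N)\<^sup>2 \<partial>N j)
      \<le> (\<integral>y. (\<Sum>i\<in>I. \<integral>x. D i (x(j := y)) \<partial>PiM I N) \<partial>N j)"
  proof (rule integral_mono)
    show "integrable (N j) (\<lambda>y. (\<integral>x. (F x y)\<^sup>2 \<partial>PiM I N) - (\<integral>x. F x y \<partial>PiM I N)\<^sup>2)"
    proof (intro Bochner_Integration.integrable_diff Q.integrable_bounded[where L = "L\<^sup>2"])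
      show "\<bar>\<integral>x. (F x y)\<^sup>2 \<partial>PiM I N\<bar> \<le> L\<^sup>2" for y
        unfolding F_def by (rule P.abs_expectation_le[OF sq[OF bd]])
      show "\<bar>(\<integral>x. F x y \<partial>PiM I N)\<^sup>2\<bar> \<le> L\<^sup>2" for y
        unfolding F_def by (rule sq[OF P.abs_expectation_le[OF bd]])
    qed measurable
    show "integrable (N j) (\<lambda>y. \<Sum>i\<in>I. \<integral>x. D i (x(j := y)) \<partial>PiM I N)"
      by (intro Bochner_Integration.integrable_sum Q.integrable_bounded[OF _ P.abs_expectation_le[OF Db]]) measurable
    fix y assume [measurable]: "y \<in> space (N j)"
    have "(\<lambda>x. F x y) \<in> borel_measurable (PiM I N)" by measurable
    then have "(\<integral>x. (F x y)\<^sup>2 \<partial>PiM I N) - (\<integral>x. F x y \<partial>PiM I N)\<^sup>2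
        \<le> (\<Sum>i\<in>I. \<integral>x. (\<integral>z. (max 0 (F (x(i := z)) y - F x y))\<^sup>2 \<partial>N i) \<partial>PiM I N)"
      by (rule insert.IH) (simp add: F_def bd)
    also have "\<dots> = (\<Sum>i\<in>I. \<integral>x. D i (x(j := y)) \<partial>PiM I N)"
      by (intro sum.cong refl Bochner_Integration.integral_cong) (simp add: DI F_def)
    finally show "(\<integral>x. (F x y)\<^sup>2 \<partial>PiM I N) - (\<integral>x. F x y \<partial>PiM I N)\<^sup>2
        \<le> (\<Sum>i\<in>I. \<integral>x. D i (x(j := y)) \<partial>PiM I N)" .
  qed
  also have "\<dots> = (\<Sum>i\<in>I. \<integral>y. (\<integral>x. D i (x(j := y)) \<partial>PiM I N) \<partial>N j)"
    by (intro Bochner_Integration.integral_sum Q.integrable_bounded[OF _ P.abs_expectation_le[OF Db]]) measurable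
  also have "\<dots> = (\<Sum>i\<in>I. \<integral>x. D i x \<partial>PiM (insert j I) N)"
    by (intro sum.cong refl fold'[OF _ Db, symmetric]) measurable
  also have "(\<integral>x. (\<integral>y. (F x y)\<^sup>2 \<partial>N j) - (\<integral>y. F x y \<partial>N j)\<^sup>2 \<partial>PiM I N)
      \<le> (\<integral>x. (\<integral>y. D j (x(j := y)) \<partial>N j) \<partial>PiM I N)"
  proof (rule integral_mono)
    show "integrable (PiM I N) (\<lambda>x. (\<integral>y. (F x y)\<^sup>2 \<partial>N j) - (\<integral>y. F x y \<partial>N j)\<^sup>2)"
    proof (intro Bochner_Integration.integrable_diff P.integrable_bounded[where L = "L\<^sup>2"])
      show "\<bar>\<integral>y. (F x y)\<^sup>2 \<partial>N j\<bar> \<le> L\<^sup>2" for x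
        unfolding F_def by (rule Q.abs_expectation_le[OF sq[OF bd]])
      show "\<bar>(\<integral>y. F x y \<partial>N j)\<^sup>2\<bar> \<le> L\<^sup>2" for x
        unfolding F_def by (rule sq[OF Q.abs_expectation_le[OF bd]])
    qed measurable
    show "integrable (PiM I N) (\<lambda>x. \<integral>y. D j (x(j := y)) \<partial>N j)"
      by (intro P.integrable_bounded[OF _ Q.abs_expectation_le[OF Db]]) measurable
    fix x assume [measurable]: "x \<in> space (PiM I N)"
    have "F x \<in> borel_measurable (N j)" by measurable
    from Q.variance_le_positive_parts[OF this, where L = L]
    show "(\<integral>y. (F x y)\<^sup>2 \<partial>N j) - (\<integral>y. F x y \<partial>N j)\<^sup>2 \<le> (\<integral>y. D j (x(j := y)) \<partial>N j)"
      by (simp add: DJ) (simp add: F_def bd)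
  qed
  also have "\<dots> = (\<integral>x. D j x \<partial>PiM (insert j I) N)"
    by (rule fold[OF _ Db, symmetric]) measurable
  finally show ?case unfolding sum.insert[OF insert.hyps] D_def by linarith
qed

section \<open>Limits and sums of square-integrable variables\<close>

text \<open>Dominated convergence for \<open>X k\<close> and for its square. It serves twice: to
  remove the truncation of a minimum, and to pass from constrained minima to the unconstrained
  one.\<close>

lemma (in prob_space) variance_le_lim:
  fixes X :: "nat \<Rightarrow> 'a \<Rightarrow> real"
  assumes [measurable]: "\<And>k. X k \<in> borel_measurable M" "Y \<in> borel_measurable M" "g \<in> borel_measurable M"
    and lim: "\<And>\<omega>. \<omega> \<in> space M \<Longrightarrow> (\<lambda>k. X k \<omega>) \<longlonglongrightarrow> Y \<omega>"
    and bd: "\<And>k \<omega>. \<omega> \<in> space M \<Longrightarrow> \<bar>X k \<omega>\<bar> \<le> g \<omega>"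
    and g2: "integrable M (\<lambda>\<omega>. (g \<omega>)\<^sup>2)"
    and var: "\<And>k. variance (X k) \<le> B"
  shows "variance Y \<le> B"
proof -
  have g1: "integrable M g" by (rule square_integrable_imp_integrable[OF _ g2]) simp
  have bd2: "\<bar>(X k \<omega>)\<^sup>2\<bar> \<le> (g \<omega>)\<^sup>2" if "\<omega> \<in> space M" for k \<omega>
    using bd[OF that, of k] by (simp add: abs_le_square_iff[symmetric])
  have limY: "\<bar>Y \<omega>\<bar> \<le> g \<omega>" if "\<omega> \<in> space M" for \<omega>
    by (rule tendsto_upperbound[OF tendsto_rabs[OF lim[OF that]]]) (use bd[OF that] in auto)
  have limY2: "\<bar>(Y \<omega>)\<^sup>2\<bar> \<le> (g \<omega>)\<^sup>2" if "\<omega> \<in> space M" for \<omega>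
    using limY[OF that] by (simp add: abs_le_square_iff[symmetric])
  have iX: "integrable M (X k)" "integrable M (\<lambda>\<omega>. (X k \<omega>)\<^sup>2)" for k
    using order_trans[OF bd[of _ k] abs_ge_self] bd2[of _ k] by (auto intro: Bochner_Integration.integrable_bound[OF g1] Bochner_Integration.integrable_bound[OF g2])
  have iY: "integrable M Y" "integrable M (\<lambda>\<omega>. (Y \<omega>)\<^sup>2)"
    using order_trans[OF limY abs_ge_self] limY2 by (auto intro: Bochner_Integration.integrable_bound[OF g1] Bochner_Integration.integrable_bound[OF g2])
  have "(\<lambda>k. expectation (X k)) \<longlonglongrightarrow> expectation Y"
    by (rule integral_dominated_convergence[OF _ _ g1]) (use lim bd in auto)
  moreover have "(\<lambda>k. expectation (\<lambda>\<omega>. (X k \<omega>)\<^sup>2)) \<longlonglongrightarrow> expectation (\<lambda>\<omega>. (Y \<omega>)\<^sup>2)"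
    by (rule integral_dominated_convergence[OF _ _ g2]) (use lim bd2 in \<open>auto intro!: tendsto_intros AE_I2\<close>)
  ultimately have "(\<lambda>k. variance (X k)) \<longlonglongrightarrow> variance Y"
    unfolding variance_eq[OF iX] variance_eq[OF iY] by (intro tendsto_intros)
  then show ?thesis by (rule tendsto_upperbound) (use var in auto)
qed

text \<open>The series of squares has finite mean, so it converges almost surely and its terms
  vanish. No threshold-by-threshold Borel--Cantelli argument is involved.\<close>

lemma AE_tendsto_zero_of_summable:
  fixes Z :: "nat \<Rightarrow> 'a \<Rightarrow> real"
  assumes int: "\<And>j. integrable M (\<lambda>\<omega>. (Z j \<omega>)\<^sup>2)"
    and le: "\<And>j. (\<integral>\<omega>. (Z j \<omega>)\<^sup>2 \<partial>M) \<le> a j" and a: "summable a"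
  shows "AE \<omega> in M. (\<lambda>j. Z j \<omega>) \<longlonglongrightarrow> 0"
proof -
  have [measurable]: "(\<lambda>\<omega>. (Z j \<omega>)\<^sup>2) \<in> borel_measurable M" for j
    using int[of j] by auto
  have a0: "0 \<le> a j" for j by (rule order_trans[OF _ le[of j]]) simp
  have "(\<integral>\<^sup>+\<omega>. (\<Sum>j. ennreal ((Z j \<omega>)\<^sup>2)) \<partial>M) = (\<Sum>j. \<integral>\<^sup>+\<omega>. ennreal ((Z j \<omega>)\<^sup>2) \<partial>M)"
    by (rule nn_integral_suminf) simp
  also have "\<dots> \<le> (\<Sum>j. ennreal (a j))"
    by (intro suminf_le allI) (auto simp: nn_integral_eq_integral[OF int] le intro!: ennreal_leI)
  also have "\<dots> < \<infinity>"
    using suminf_ennreal_eq[OF a0 summable_sums[OF a]] by simp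
  finally have "AE \<omega> in M. (\<Sum>j. ennreal ((Z j \<omega>)\<^sup>2)) \<noteq> \<infinity>"
    by (intro nn_integral_noteq_infinite) auto
  then show ?thesis
  proof eventually_elim
    case (elim \<omega>)
    then have "summable (\<lambda>j. (Z j \<omega>)\<^sup>2)"
      by (intro summable_suminf_not_top) (auto simp: top_ennreal_def[symmetric] infinity_ennreal_def)
    then have "(\<lambda>j. (Z j \<omega>)\<^sup>2) \<longlonglongrightarrow> 0" by (rule summable_LIMSEQ_zero)
    then have "(\<lambda>j. sqrt ((Z j \<omega>)\<^sup>2)) \<longlonglongrightarrow> sqrt 0" by (rule tendsto_real_sqrt)
    then show ?case by (simp add: tendsto_rabs_zero_iff)
  qed
qed

text \<open>The new summand is uncorrelated with the sum of the others. Square integrability is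
  carried through the induction because the second-moment form of the variance requires it.\<close>

lemma (in prob_space) variance_sum_indep:
  fixes X :: "'i \<Rightarrow> 'a \<Rightarrow> real"
  assumes "finite I" "indep_vars (\<lambda>_. borel) X I" "\<And>i. i \<in> I \<Longrightarrow> integrable M (\<lambda>\<omega>. (X i \<omega>)\<^sup>2)"
  shows "integrable M (\<lambda>\<omega>. (\<Sum>i\<in>I. X i \<omega>)\<^sup>2) \<and> variance (\<lambda>\<omega>. \<Sum>i\<in>I. X i \<omega>) = (\<Sum>i\<in>I. variance (X i))"
  using assms
proof (induction I rule: finite_induct)
  case (insert i I)
  let ?S = "\<lambda>\<omega>. \<Sum>i\<in>I. X i \<omega>"
  have [measurable]: "random_variable borel (X j)" if "j \<in> insert i I" for j
    using insert.prems(1) that by (auto simp: indep_vars_def)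
  have Xi2: "integrable M (\<lambda>\<omega>. (X i \<omega>)\<^sup>2)" using insert.prems by auto
  have "random_variable borel (X i)" by simp
  then have Xi: "integrable M (X i)" by (rule square_integrable_imp_integrable[OF _ Xi2])
  have IH: "integrable M (\<lambda>\<omega>. (?S \<omega>)\<^sup>2)" "variance ?S = (\<Sum>i\<in>I. variance (X i))"
    using insert.IH[OF indep_vars_subset[OF insert.prems(1)]] insert.prems(2) by auto
  have "random_variable borel ?S" by simp
  then have Si: "integrable M ?S" by (rule square_integrable_imp_integrable[OF _ IH(1)])
  have ind: "indep_var borel (X i) borel ?S" by (rule indep_vars_sum[OF insert.hyps insert.prems(1)])
  note prod = indep_var_integrable[OF ind Xi Si] indep_var_lebesgue_integral[OF ind Xi Si]
  have eq: "(\<lambda>\<omega>. (\<Sum>i\<in>insert i I. X i \<omega>)\<^sup>2) = (\<lambda>\<omega>. (X i \<omega>)\<^sup>2 + (?S \<omega>)\<^sup>2 + 2 * (X i \<omega> * ?S \<omega>))"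
    using insert.hyps by (simp add: power2_sum mult.assoc)
  have i2: "integrable M (\<lambda>\<omega>. (\<Sum>i\<in>insert i I. X i \<omega>)\<^sup>2)"
    unfolding eq using Xi2 IH prod by simp
  have i1: "integrable M (\<lambda>\<omega>. \<Sum>i\<in>insert i I. X i \<omega>)" using insert.hyps Xi Si by simp
  have "variance (\<lambda>\<omega>. \<Sum>i\<in>insert i I. X i \<omega>) = variance (X i) + variance ?S"
    unfolding variance_eq[OF i1 i2] variance_eq[OF Xi Xi2] variance_eq[OF Si IH(1)]
    unfolding eq using insert.hyps Xi2 IH(1) Xi Si prod by (simp add: power2_sum)
  with i2 show ?case using insert.hyps IH(2) by simp
qed simp

section \<open>Lower deviations of passage times along paths\<close>

lemma borel_measurable_passage_time:
  assumes "is_path d ws" "\<And>e. e \<in> edges d \<Longrightarrow> t e \<in> borel_measurable M"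
  shows "passage_time t ws \<in> borel_measurable M"
proof -
  have "passage_time t ws = (\<lambda>\<omega>. \<Sum>e\<in>path_edges ws. t e \<omega>)"
    using assms(1) by (intro ext passage_time_eq_sum) (auto simp: is_path_def)
  then show ?thesis
    using path_edges_subset[OF assms(1)] assms(2) by (auto intro!: borel_measurable_sum)
qed

text \<open>Nonnegativity is demanded everywhere and for every set \<open>e\<close>, not just almost
  surely on edges: infima over paths are then bounded below at each point, with no exceptional set.
  The absolute values of the original weights satisfy this. \<open>\<mu>\<close> may be any uniform
  bound on the second moments.\<close>

locale first_passage = prob_space M for M :: "'a measure" +
  fixes d :: nat and t :: "(nat \<Rightarrow> int) set \<Rightarrow> 'a \<Rightarrow> real" and \<mu> :: real
  assumes d: "d \<ge> 1"
    and indep: "indep_vars (\<lambda>_. borel) t (edges d)"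
    and nonneg: "\<And>e \<omega>. 0 \<le> t e \<omega>"
    and t2_integrable: "\<And>e. e \<in> edges d \<Longrightarrow> integrable M (\<lambda>\<omega>. (t e \<omega>)\<^sup>2)"
    and t2_le: "\<And>e. e \<in> edges d \<Longrightarrow> expectation (\<lambda>\<omega>. (t e \<omega>)\<^sup>2) \<le> \<mu>"
    and small: "\<And>\<delta>. \<delta> > 0 \<Longrightarrow> \<exists>\<epsilon>>0. \<forall>e\<in>edges d. prob {\<omega> \<in> space M. t e \<omega> \<le> \<epsilon>} \<le> \<delta>"
begin

lemma t_measurable: "e \<in> edges d \<Longrightarrow> t e \<in> borel_measurable M"
  using indep by (auto simp: indep_vars_def)

lemma passage_time_measurable: "is_path d ws \<Longrightarrow> passage_time t ws \<in> borel_measurable M"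
  by (intro borel_measurable_passage_time[where d = d] t_measurable)

lemma passage_time_nonneg: "0 \<le> passage_time t ws \<omega>"
  unfolding passage_time_def by (intro sum_nonneg nonneg)

text \<open>The endpoint of the path is free, so the event does not depend on the target; this is
  the source of uniformity in \<open>n\<close> and \<open>k\<close>.\<close>

definition slow :: "real \<Rightarrow> nat \<Rightarrow> 'a set" where
  "slow c r = {\<omega> \<in> space M. \<exists>ws\<in>paths_of_length d r. passage_time t ws \<omega> \<le> c * real r}"

lemma slow_eq: "slow c r = (\<Union>ws\<in>paths_of_length d r. {\<omega> \<in> space M. passage_time t ws \<omega> \<le> c * real r})"
  by (auto simp: slow_def)

lemma slow_path_measurable:
  "ws \<in> paths_of_length d r \<Longrightarrow> {\<omega> \<in> space M. passage_time t ws \<omega> \<le> c * real r} \<in> events"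
proof -
  assume "ws \<in> paths_of_length d r"
  then have [measurable]: "passage_time t ws \<in> borel_measurable M"
    by (intro passage_time_measurable) (auto simp: paths_of_length_def)
  show ?thesis by measurable
qed

lemma slow_measurable [measurable]: "slow c r \<in> events"
  unfolding slow_eq using paths_of_length[OF d, of r] slow_path_measurable
  by (intro sets.finite_UN) auto

text \<open>An exponential Markov bound for each path, then a union bound over the paths. The
  small-ball condition, being uniform over the edges, makes the Laplace transform of each weight
  small enough to beat the path count.\<close>

lemma prob_slow: "\<exists>c>0. \<forall>r. prob (slow c r) \<le> (1 / 4) ^ r"
proof -
  \<comment> \<open>A single path will contribute \<open>(4 * \<delta>) ^ r\<close>, and this choice
    gives \<open>2 * d * (4 * \<delta>) = 1 / 4\<close>. The ratio 1/4 leaves room for a factor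
    \<open>r\<close> later on.\<close>
  define \<delta> where "\<delta> = 1 / (32 * real d)"
  have \<delta>: "0 < \<delta>" "\<delta> < 1" using d by (auto simp: \<delta>_def field_simps)
  from small[OF \<delta>(1)] obtain \<epsilon> where \<epsilon>: "\<epsilon> > 0"
    and p\<epsilon>: "\<And>e. e \<in> edges d \<Longrightarrow> prob {\<omega> \<in> space M. t e \<omega> \<le> \<epsilon>} \<le> \<delta>" by blast
  \<comment> \<open>With this \<open>s\<close>, weights above \<open>\<epsilon>\<close> contribute
    at most \<open>exp (- (s * \<epsilon>)) = \<delta>\<close> to the Laplace transform, the same
    bound as for those below. The choice of \<open>c\<close> makes the Markov factor
    \<open>exp (s * c)\<close> per edge equal to 2.\<close>
  define s where "s = ln (1 / \<delta>) / \<epsilon>"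
  define c where "c = ln 2 / s"
  have s: "s > 0" using \<delta> \<epsilon> by (auto simp: s_def)
  have c: "c > 0" using s by (auto simp: c_def)
  have s\<epsilon>: "exp (- (s * \<epsilon>)) = \<delta>" using \<delta> \<epsilon> by (simp add: s_def ln_div)
  have laplace: "integrable M (\<lambda>\<omega>. exp (- (s * t e \<omega>)))" "expectation (\<lambda>\<omega>. exp (- (s * t e \<omega>))) \<le> 2 * \<delta>"
    if e: "e \<in> edges d" for e
  proof -
    have [measurable]: "t e \<in> borel_measurable M" by (rule t_measurable[OF e])
    have "\<bar>exp (- (s * t e \<omega>))\<bar> \<le> 1" for \<omega> using s nonneg[of e \<omega>] by simp
    then show i: "integrable M (\<lambda>\<omega>. exp (- (s * t e \<omega>)))" by (intro integrable_bounded[where L = 1]) auto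
    have "expectation (\<lambda>\<omega>. exp (- (s * t e \<omega>))) \<le> expectation (\<lambda>\<omega>. indicator {\<omega> \<in> space M. t e \<omega> \<le> \<epsilon>} \<omega> + \<delta>)"
    proof (rule integral_mono[OF i])
      show "integrable M (\<lambda>\<omega>. indicator {\<omega> \<in> space M. t e \<omega> \<le> \<epsilon>} \<omega> + \<delta>)"
        by (intro Bochner_Integration.integrable_add integrable_real_indicator) (auto simp: emeasure_eq_measure)
      fix \<omega> assume \<omega>: "\<omega> \<in> space M"
      show "exp (- (s * t e \<omega>)) \<le> indicator {\<omega> \<in> space M. t e \<omega> \<le> \<epsilon>} \<omega> + \<delta>"
      proof (cases "t e \<omega> \<le> \<epsilon>")
        case True
        have "exp (- (s * t e \<omega>)) \<le> 1" using s nonneg[of e \<omega>] by simp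
        then have "exp (- (s * t e \<omega>)) \<le> 1 + \<delta>" using \<delta> by linarith
        then show ?thesis using True \<omega> by simp
      next
        case False
        then have "exp (- (s * t e \<omega>)) \<le> exp (- (s * \<epsilon>))" using s by simp
        then show ?thesis using False s\<epsilon> by simp
      qed
    qed
    also have "\<dots> = prob {\<omega> \<in> space M. t e \<omega> \<le> \<epsilon>} + \<delta>"
      by (subst Bochner_Integration.integral_add)
        (auto simp: prob_space emeasure_eq_measure intro!: integrable_real_indicator)
    finally show "expectation (\<lambda>\<omega>. exp (- (s * t e \<omega>))) \<le> 2 * \<delta>" using p\<epsilon>[OF e] by simp
  qed
  have path: "prob {\<omega> \<in> space M. passage_time t ws \<omega> \<le> c * real r} \<le> (4 * \<delta>) ^ r"
    if ws: "ws \<in> paths_of_length d r" for ws r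
  proof -
    have p: "is_path d ws" and r: "path_length ws = r" using ws by (auto simp: paths_of_length_def)
    have di: "distinct ws" using p by (auto simp: is_path_def)
    have sub: "path_edges ws \<subseteq> edges d" by (rule path_edges_subset[OF p])
    have iv: "indep_vars (\<lambda>_. borel) (\<lambda>e \<omega>. exp (- (s * t e \<omega>))) (path_edges ws)"
      by (rule indep_vars_compose2[OF indep_vars_subset[OF indep sub]]) simp
    have ex: "exp (- (s * passage_time t ws \<omega>)) = (\<Prod>e\<in>path_edges ws. exp (- (s * t e \<omega>)))" for \<omega>
      by (simp add: passage_time_eq_sum[OF di] exp_sum[symmetric] sum_distrib_left sum_negf)
    have int: "integrable M (\<lambda>\<omega>. exp (- (s * passage_time t ws \<omega>)))"
      unfolding ex using sub laplace by (intro indep_vars_integrable[OF _ iv]) auto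
    have "expectation (\<lambda>\<omega>. exp (- (s * passage_time t ws \<omega>)))
        = (\<Prod>e\<in>path_edges ws. expectation (\<lambda>\<omega>. exp (- (s * t e \<omega>))))"
      unfolding ex using sub laplace by (intro indep_vars_lebesgue_integral[OF _ iv]) auto
    also have "\<dots> \<le> (\<Prod>e\<in>path_edges ws. 2 * \<delta>)"
      using sub laplace by (intro prod_mono) auto
    also have "\<dots> = (2 * \<delta>) ^ r" by (simp add: card_path_edges[OF di] r)
    finally have E: "expectation (\<lambda>\<omega>. exp (- (s * passage_time t ws \<omega>))) \<le> (2 * \<delta>) ^ r" .
    have [measurable]: "passage_time t ws \<in> borel_measurable M" by (rule passage_time_measurable[OF p])
    have "prob {\<omega> \<in> space M. passage_time t ws \<omega> \<le> c * real r}
        = expectation (\<lambda>\<omega>. indicator {\<omega> \<in> space M. passage_time t ws \<omega> \<le> c * real r} \<omega>)" by simp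
    also have "\<dots> \<le> expectation (\<lambda>\<omega>. 2 ^ r * exp (- (s * passage_time t ws \<omega>)))"
    proof (rule integral_mono)
      fix \<omega> assume "\<omega> \<in> space M"
      have "1 \<le> 2 ^ r * exp (- (s * passage_time t ws \<omega>))" if "passage_time t ws \<omega> \<le> c * real r"
      proof -
        have "s * passage_time t ws \<omega> \<le> s * (c * real r)" using that s by simp
        also have "\<dots> = real r * ln 2" using s by (simp add: c_def)
        finally have "exp (- (real r * ln 2)) \<le> exp (- (s * passage_time t ws \<omega>))" by simp
        moreover have "exp (- (real r * ln 2)) = 1 / 2 ^ r"
          by (simp add: exp_minus exp_of_nat_mult inverse_eq_divide)
        ultimately show ?thesis by (simp add: field_simps)
      qed
      then show "indicator {\<omega> \<in> space M. passage_time t ws \<omega> \<le> c * real r} \<omega> \<le> 2 ^ r * exp (- (s * passage_time t ws \<omega>))"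
        by (auto simp: indicator_def)
    qed (use int in \<open>auto simp: emeasure_eq_measure intro!: integrable_real_indicator\<close>)
    also have "\<dots> \<le> 2 ^ r * (2 * \<delta>) ^ r" using E by simp
    also have "\<dots> = (2 * (2 * \<delta>)) ^ r" by (rule power_mult_distrib[symmetric])
    also have "2 * (2 * \<delta>) = 4 * \<delta>" by simp
    finally show ?thesis .
  qed
  have "prob (slow c r) \<le> (1 / 4) ^ r" for r
  proof -
    have fin: "finite (paths_of_length d r)" and card: "card (paths_of_length d r) \<le> (2 * d) ^ r"
      using paths_of_length[OF d] by auto
    have "prob (slow c r) \<le> (\<Sum>ws\<in>paths_of_length d r. prob {\<omega> \<in> space M. passage_time t ws \<omega> \<le> c * real r})"
      unfolding slow_eq using fin slow_path_measurable by (intro finite_measure_subadditive_finite) auto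
    also have "\<dots> \<le> real (card (paths_of_length d r)) * (4 * \<delta>) ^ r"
      using path sum_bounded_above[of "paths_of_length d r" _ "(4 * \<delta>) ^ r"] by simp
    also have "\<dots> \<le> real ((2 * d) ^ r) * (4 * \<delta>) ^ r"
      using \<delta> by (intro mult_right_mono of_nat_mono card) auto
    also have "\<dots> = (2 * real d * (4 * \<delta>)) ^ r"
      by (simp only: of_nat_power of_nat_mult of_nat_numeral power_mult_distrib mult.assoc)
    also have "2 * real d * (4 * \<delta>) = 1 / 4" using d by (simp add: \<delta>_def)
    finally show ?thesis .
  qed
  with c show ?thesis by blast
qed

end

section \<open>Minimum passage times\<close>

text \<open>\<open>prob_slow\<close> yields \<open>c\<close> only existentially; as a parameter it
  can appear in the explicit constants below, which depend on \<open>c\<close> and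
  \<open>\<mu>\<close> alone.\<close>

locale first_passage_speed = first_passage +
  fixes c :: real
  assumes c: "c > 0" and prob_slow_le: "\<And>r. prob (slow c r) \<le> (1 / 4) ^ r"
begin

text \<open>Real-valued counterparts of the extended real minima, so that integration theory applies
  directly. For \<open>k < n\<close> the index set of \<open>min_passage_upto\<close> is empty and
  its value carries no meaning, whence the recurring condition \<open>n \<le> k\<close>.\<close>

definition min_passage :: "nat \<Rightarrow> 'a \<Rightarrow> real" where
  "min_passage n \<omega> = (INF ws\<in>paths d n. passage_time t ws \<omega>)"

definition min_passage_upto :: "nat \<Rightarrow> nat \<Rightarrow> 'a \<Rightarrow> real" where
  "min_passage_upto n k \<omega> = (INF ws\<in>paths_upto d n k. passage_time t ws \<omega>)"

text \<open>For \<open>m = 0\<close> this is the passage time of the straight path, the common upper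
  bound of all minima; general \<open>m\<close> is for comparing two targets.\<close>

definition axis_time :: "nat \<Rightarrow> nat \<Rightarrow> 'a \<Rightarrow> real" where
  "axis_time m n \<omega> = (\<Sum>i=m..<n. t (axis_edge i) \<omega>)"

lemma bdd_below_passage_time [simp]: "bdd_below ((\<lambda>ws. passage_time t ws \<omega>) ` A)"
  by (rule bdd_belowI2[of _ 0]) (rule passage_time_nonneg)

lemma paths_upto_subset: "paths_upto d n k \<subseteq> paths d n"
  by (auto simp: paths_upto_eq)

lemma paths_upto_nonempty: "n \<le> k \<Longrightarrow> paths_upto d n k \<noteq> {}"
  using straight_in_paths_upto[OF d] by auto

lemma paths_nonempty [simp]: "paths d n \<noteq> {}"
  using paths_upto_nonempty[of n n] paths_upto_subset by blast

lemma min_passage_le: "ws \<in> paths d n \<Longrightarrow> min_passage n \<omega> \<le> passage_time t ws \<omega>"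
  unfolding min_passage_def by (rule cINF_lower) simp_all

lemma min_passage_upto_le: "ws \<in> paths_upto d n k \<Longrightarrow> min_passage_upto n k \<omega> \<le> passage_time t ws \<omega>"
  unfolding min_passage_upto_def by (rule cINF_lower) simp_all

lemma min_passage_upto_attained: "n \<le> k \<Longrightarrow> \<exists>ws\<in>paths_upto d n k. min_passage_upto n k \<omega> = passage_time t ws \<omega>"
proof -
  assume "n \<le> k"
  then have A: "finite ((\<lambda>ws. passage_time t ws \<omega>) ` paths_upto d n k)" "(\<lambda>ws. passage_time t ws \<omega>) ` paths_upto d n k \<noteq> {}"
    using paths_upto_nonempty finite_paths_upto[OF d] by auto
  have "min_passage_upto n k \<omega> \<in> (\<lambda>ws. passage_time t ws \<omega>) ` paths_upto d n k"
    unfolding min_passage_upto_def cInf_eq_Min[OF A] by (rule Min_in[OF A])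
  then show ?thesis by auto
qed

lemma min_passage_nonneg: "0 \<le> min_passage n \<omega>"
  unfolding min_passage_def by (rule cINF_greatest) (auto simp: passage_time_nonneg)

lemma min_passage_le_min_passage_upto: "n \<le> k \<Longrightarrow> min_passage n \<omega> \<le> min_passage_upto n k \<omega>"
  using min_passage_upto_attained[of n k \<omega>] min_passage_le paths_upto_subset by fastforce

lemma min_passage_upto_nonneg: "n \<le> k \<Longrightarrow> 0 \<le> min_passage_upto n k \<omega>"
  using min_passage_le_min_passage_upto min_passage_nonneg order_trans by blast

lemma min_passage_upto_le_axis_time: "n \<le> k \<Longrightarrow> min_passage_upto n k \<omega> \<le> axis_time 0 n \<omega>"
  using min_passage_upto_le[OF straight_in_paths_upto[OF d]] by (simp add: axis_time_def passage_time_straight atLeast0LessThan)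

lemma min_passage_le_axis_time: "min_passage n \<omega> \<le> axis_time 0 n \<omega>"
  using min_passage_le_min_passage_upto[of n n \<omega>] min_passage_upto_le_axis_time[of n n \<omega>] by simp

lemma min_time_upto_eq: "n \<le> k \<Longrightarrow> min_time_upto d t n k \<omega> = ereal (min_passage_upto n k \<omega>)"
  unfolding min_time_upto_def min_passage_upto_def
  using ereal_Inf'[of "(\<lambda>ws. passage_time t ws \<omega>) ` paths_upto d n k"] paths_upto_nonempty
  by (simp add: image_comp)

lemma min_time_eq: "min_time d t n \<omega> = ereal (min_passage n \<omega>)"
proof -
  have "min_time d t n \<omega> = (INF ws\<in>paths d n. ereal (passage_time t ws \<omega>))"
    unfolding min_time_def min_time_upto_def
  proof (rule antisym)
    show "(INF ws\<in>paths d n. ereal (passage_time t ws \<omega>))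
        \<le> (INF k\<in>{1..}. INF ws\<in>paths_upto d n k. ereal (passage_time t ws \<omega>))"
      using paths_upto_subset by (intro INF_greatest INF_lower) auto
    show "(INF k\<in>{1..}. INF ws\<in>paths_upto d n k. ereal (passage_time t ws \<omega>))
        \<le> (INF ws\<in>paths d n. ereal (passage_time t ws \<omega>))"
    proof (rule INF_greatest)
      fix ws assume "ws \<in> paths d n"
      \<comment> \<open>The range of \<open>k\<close> starts at 1, whereas the trivial path, which
        occurs for \<open>n = 0\<close>, has length 0.\<close>
      then have "ws \<in> paths_upto d n (max 1 (path_length ws))" by (simp add: paths_upto_eq)
      then show "(INF k\<in>{1..}. INF ws\<in>paths_upto d n k. ereal (passage_time t ws \<omega>)) \<le> ereal (passage_time t ws \<omega>)"
        by (intro INF_lower2[of "max 1 (path_length ws)"] INF_lower2[of ws]) auto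
    qed
  qed
  also have "\<dots> = ereal (min_passage n \<omega>)"
    unfolding min_passage_def using ereal_Inf'[of "(\<lambda>ws. passage_time t ws \<omega>) ` paths d n"]
    by (simp add: image_comp)
  finally show ?thesis .
qed

lemma min_passage_neighbour:
  assumes "adjacent d (axis_point n) (axis_point m)"
  shows "min_passage m \<omega> \<le> min_passage n \<omega> + t {axis_point n, axis_point m} \<omega>"
proof -
  have "min_passage m \<omega> - t {axis_point n, axis_point m} \<omega> \<le> min_passage n \<omega>"
    unfolding min_passage_def[of n]
  proof (rule cINF_greatest)
    fix ws assume "ws \<in> paths d n"
    from paths_extend[where t = t and \<omega> = \<omega>, OF d this assms nonneg] obtain vs where
      "vs \<in> paths d m" "passage_time t vs \<omega> \<le> passage_time t ws \<omega> + t {axis_point n, axis_point m} \<omega>"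
      by blast
    with min_passage_le[of vs m \<omega>] show "min_passage m \<omega> - t {axis_point n, axis_point m} \<omega> \<le> passage_time t ws \<omega>"
      by linarith
  qed simp
  then show ?thesis by simp
qed

text \<open>Telescoping over neighbouring axis points, with extension of paths in both directions.
  This takes the place of monotonicity in \<open>n\<close>, which fails in general.\<close>

lemma min_passage_diff_le: "m \<le> n \<Longrightarrow> \<bar>min_passage n \<omega> - min_passage m \<omega>\<bar> \<le> axis_time m n \<omega>"
proof (induction n rule: dec_induct)
  case (step n)
  have "\<bar>min_passage (Suc n) \<omega> - min_passage n \<omega>\<bar> \<le> t (axis_edge n) \<omega>"
    using min_passage_neighbour[OF adjacent_axis(1)[OF d, of n], of \<omega>] min_passage_neighbour[OF adjacent_axis(2)[OF d, of n], of \<omega>]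
    by (simp add: axis_edge_def insert_commute abs_le_iff)
  then show ?case using step by (simp add: axis_time_def)
qed (simp add: axis_time_def)

text \<open>A nearly optimal path has finite length and becomes admissible once \<open>k\<close>
  exceeds it. The shift by \<open>n\<close> avoids empty families.\<close>

lemma min_passage_upto_tendsto: "(\<lambda>k. min_passage_upto n (n + k) \<omega>) \<longlonglongrightarrow> min_passage n \<omega>"
proof (rule order_tendstoI)
  fix a assume "a < min_passage n \<omega>"
  then show "\<forall>\<^sub>F k in sequentially. a < min_passage_upto n (n + k) \<omega>"
    using min_passage_le_min_passage_upto[of n _ \<omega>] by (intro always_eventually allI less_le_trans[OF _ min_passage_le_min_passage_upto]) auto
next
  fix a assume "min_passage n \<omega> < a"
  then obtain ws where ws: "ws \<in> paths d n" "passage_time t ws \<omega> < a"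
    unfolding min_passage_def by (subst (asm) cINF_less_iff) auto
  have "min_passage_upto n (n + k) \<omega> < a" if "path_length ws \<le> k" for k
    using ws that min_passage_upto_le[of ws n "n + k" \<omega>] by (auto simp: paths_upto_eq)
  then show "\<forall>\<^sub>F k in sequentially. min_passage_upto n (n + k) \<omega> < a"
    using eventually_ge_at_top[of "path_length ws"] by (rule eventually_mono[rotated])
qed

text \<open>A path that beats the constrained minimum is inadmissible, hence longer than
  \<open>k\<close>; it also beats the straight path, which is admissible. Disagreement thus produces
  a path that is long and cheap at once.\<close>

lemma min_passage_neqD:
  assumes "n \<le> k" "min_passage n \<omega> \<noteq> min_passage_upto n k \<omega>"
  shows "\<exists>ws\<in>paths d n. k < path_length ws \<and> passage_time t ws \<omega> < axis_time 0 n \<omega>"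
proof -
  have "min_passage n \<omega> < min_passage_upto n k \<omega>" using assms min_passage_le_min_passage_upto[of n k \<omega>] by auto
  then obtain ws where ws: "ws \<in> paths d n" "passage_time t ws \<omega> < min_passage_upto n k \<omega>"
    unfolding min_passage_def by (subst (asm) cINF_less_iff) auto
  then have "ws \<notin> paths_upto d n k" using min_passage_upto_le[of ws n k \<omega>] by auto
  with ws min_passage_upto_le_axis_time[OF assms(1), of \<omega>] show ?thesis by (auto simp: paths_upto_eq intro!: bexI[of _ ws])
qed

section \<open>Measurability, and moments of the axis time\<close>

lemma min_passage_measurable [measurable]: "min_passage n \<in> borel_measurable M"
proof -
  have "(\<lambda>\<omega>. INF ws\<in>paths d n. passage_time t ws \<omega>) \<in> borel_measurable M"
    by (intro borel_measurable_cINF_real countable_paths[OF d] passage_time_measurable) (auto simp: paths_def)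
  then show ?thesis unfolding min_passage_def[abs_def] .
qed

lemma min_passage_upto_measurable [measurable]: "min_passage_upto n k \<in> borel_measurable M"
proof -
  have "(\<lambda>\<omega>. INF ws\<in>paths_upto d n k. passage_time t ws \<omega>) \<in> borel_measurable M"
    by (intro borel_measurable_cINF_real countable_finite[OF finite_paths_upto[OF d]] passage_time_measurable)
      (auto simp: paths_upto_def)
  then show ?thesis unfolding min_passage_upto_def[abs_def] .
qed

lemma axis_measurable [measurable]: "t (axis_edge i) \<in> borel_measurable M"
  by (rule t_measurable[OF axis_edge_edges[OF d]])

lemma axis_time_measurable [measurable]: "axis_time m n \<in> borel_measurable M"
  unfolding axis_time_def[abs_def] by measurable

lemma axis_time_nonneg: "0 \<le> axis_time m n \<omega>"
  unfolding axis_time_def by (intro sum_nonneg nonneg)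

lemma \<mu>_nonneg: "0 \<le> \<mu>"
  by (rule order_trans[OF _ t2_le[OF axis_edge_edges[OF d, of 0]]]) simp

lemma axis_time_square: "integrable M (\<lambda>\<omega>. (axis_time m n \<omega>)\<^sup>2)" "variance (axis_time m n) \<le> \<mu> * real (n - m)"
proof -
  let ?I = "axis_edge ` {m..<n}"
  have sub: "?I \<subseteq> edges d" using axis_edge_edges[OF d] by auto
  have inj: "inj_on axis_edge {m..<n}" by (rule inj_on_subset[OF inj_axis_edge]) simp
  have axis_time: "axis_time m n = (\<lambda>\<omega>. \<Sum>e\<in>?I. t e \<omega>)" by (simp add: axis_time_def[abs_def] sum.reindex[OF inj])
  have i2: "integrable M (\<lambda>\<omega>. (t e \<omega>)\<^sup>2)" if "e \<in> ?I" for e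
    using sub that by (intro t2_integrable) auto
  have i1: "integrable M (t e)" if "e \<in> ?I" for e
    using that axis_measurable by (intro square_integrable_imp_integrable[OF _ i2[OF that]]) auto
  have *: "integrable M (\<lambda>\<omega>. (axis_time m n \<omega>)\<^sup>2)" "variance (axis_time m n) = (\<Sum>e\<in>?I. variance (t e))"
    unfolding axis_time using variance_sum_indep[OF _ indep_vars_subset[OF indep sub] i2] by simp_all
  show "integrable M (\<lambda>\<omega>. (axis_time m n \<omega>)\<^sup>2)" by fact
  have "variance (t e) \<le> \<mu>" if "e \<in> ?I" for e
  proof -
    have "variance (t e) \<le> expectation (\<lambda>\<omega>. (t e \<omega>)\<^sup>2)"
      unfolding variance_eq[OF i1[OF that] i2[OF that]] by simp
    also have "\<dots> \<le> \<mu>" using sub that by (intro t2_le) auto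
    finally show ?thesis .
  qed
  then have "variance (axis_time m n) \<le> (\<Sum>e\<in>?I. \<mu>)" unfolding *(2) by (intro sum_mono)
  then show "variance (axis_time m n) \<le> \<mu> * real (n - m)" by (simp add: card_image[OF inj] mult.commute)
qed

lemma axis_time_integrable: "integrable M (axis_time m n)"
  by (rule square_integrable_imp_integrable[OF _ axis_time_square(1)]) simp

lemma axis_time_mean: "expectation (axis_time m n) \<le> (1 + \<mu>) * real (n - m)"
proof -
  have i2: "integrable M (\<lambda>\<omega>. (t (axis_edge i) \<omega>)\<^sup>2)" for i
    by (rule t2_integrable[OF axis_edge_edges[OF d]])
  have i1: "integrable M (t (axis_edge i))" for i
    by (rule square_integrable_imp_integrable[OF _ i2]) simp
  have "expectation (t (axis_edge i)) \<le> expectation (\<lambda>\<omega>. 1 + (t (axis_edge i) \<omega>)\<^sup>2)" for i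
  proof (rule integral_mono[OF i1])
    show "integrable M (\<lambda>\<omega>. 1 + (t (axis_edge i) \<omega>)\<^sup>2)" using i2 by simp
    fix \<omega>
    \<comment> \<open>Gives \<open>2 * t \<le> 1 + t\<^sup>2\<close>; the crude first-moment bound
      \<open>1 + \<mu>\<close> comes from here.\<close>
    have "0 \<le> (t (axis_edge i) \<omega> - 1)\<^sup>2" by simp
    then show "t (axis_edge i) \<omega> \<le> 1 + (t (axis_edge i) \<omega>)\<^sup>2"
      using nonneg[of "axis_edge i" \<omega>] by (simp add: power2_diff)
  qed
  also have "expectation (\<lambda>\<omega>. 1 + (t (axis_edge i) \<omega>)\<^sup>2) \<le> 1 + \<mu>" for i
    using i2[of i] t2_le[OF axis_edge_edges[OF d, of i]] by (simp add: prob_space)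
  finally have "expectation (axis_time m n) \<le> (\<Sum>i=m..<n. 1 + \<mu>)"
    unfolding axis_time_def[abs_def] by (subst Bochner_Integration.integral_sum) (auto intro!: i1 sum_mono simp del: sum_constant)
  then show ?thesis by (simp add: mult.commute)
qed

text \<open>Cauchy--Schwarz suffices: quadratic growth in the number of edges is affordable for the
  gaps between consecutive squares, where the bound is used.\<close>

lemma axis_time_second_moment: "expectation (\<lambda>\<omega>. (axis_time m n \<omega>)\<^sup>2) \<le> \<mu> * (real (n - m))\<^sup>2"
proof -
  have i2: "integrable M (\<lambda>\<omega>. (t (axis_edge i) \<omega>)\<^sup>2)" for i
    by (rule t2_integrable[OF axis_edge_edges[OF d]])
  have "expectation (\<lambda>\<omega>. (axis_time m n \<omega>)\<^sup>2) \<le> expectation (\<lambda>\<omega>. real (n - m) * (\<Sum>i=m..<n. (t (axis_edge i) \<omega>)\<^sup>2))"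
  proof (rule integral_mono[OF axis_time_square(1)])
    show "integrable M (\<lambda>\<omega>. real (n - m) * (\<Sum>i=m..<n. (t (axis_edge i) \<omega>)\<^sup>2))" using i2 by simp
    show "(axis_time m n \<omega>)\<^sup>2 \<le> real (n - m) * (\<Sum>i=m..<n. (t (axis_edge i) \<omega>)\<^sup>2)" for \<omega>
      using Cauchy_Schwarz_ineq_sum[of "\<lambda>_. 1" "\<lambda>i. t (axis_edge i) \<omega>" "{m..<n}"] by (simp add: axis_time_def)
  qed
  also have "\<dots> = real (n - m) * (\<Sum>i=m..<n. expectation (\<lambda>\<omega>. (t (axis_edge i) \<omega>)\<^sup>2))"
    using i2 by simp
  also have "\<dots> \<le> real (n - m) * (\<Sum>i=m..<n. \<mu>)"
    by (intro mult_left_mono sum_mono t2_le axis_edge_edges[OF d]) simp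
  finally show ?thesis by (simp add: power2_eq_square ac_simps)
qed

text \<open>The assumption places the mean below \<open>a / 2\<close>, so reaching \<open>a\<close>
  is a deviation of at least \<open>a / 2\<close>, and Chebyshev's inequality applies.\<close>

lemma axis_time_tail:
  assumes "n \<ge> 1" "a \<ge> 2 * (1 + \<mu>) * real n"
  shows "prob {\<omega> \<in> space M. a \<le> axis_time 0 n \<omega>} \<le> 4 * \<mu> * real n / a\<^sup>2"
proof -
  have "0 < 2 * (1 + \<mu>) * real n" using assms(1) \<mu>_nonneg by (intro mult_pos_pos) auto
  with assms(2) have a: "a > 0" by linarith
  have "prob {\<omega> \<in> space M. a \<le> axis_time 0 n \<omega>} \<le> prob {\<omega> \<in> space M. \<bar>axis_time 0 n \<omega> - expectation (axis_time 0 n)\<bar> \<ge> a / 2}"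
  proof (rule finite_measure_mono)
    show "{\<omega> \<in> space M. a \<le> axis_time 0 n \<omega>} \<subseteq> {\<omega> \<in> space M. \<bar>axis_time 0 n \<omega> - expectation (axis_time 0 n)\<bar> \<ge> a / 2}"
    proof safe
      fix \<omega> assume "a \<le> axis_time 0 n \<omega>"
      moreover have "expectation (axis_time 0 n) \<le> a / 2" using axis_time_mean[of 0 n] assms(2) by (simp add: algebra_simps)
      ultimately show "a / 2 \<le> \<bar>axis_time 0 n \<omega> - expectation (axis_time 0 n)\<bar>" by linarith
    qed
  qed measurable
  also have "\<dots> \<le> variance (axis_time 0 n) / (a / 2)\<^sup>2"
    by (rule Chebyshev_inequality) (use axis_time_square(1) a in auto)
  also have "\<dots> \<le> \<mu> * real n / (a / 2)\<^sup>2"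
    using axis_time_square(2)[of 0 n] by (intro divide_right_mono) auto
  also have "\<dots> = 4 * \<mu> * real n / a\<^sup>2" by (simp add: power_divide)
  finally show ?thesis .
qed

section \<open>Linear growth with high probability and in mean\<close>

text \<open>All lengths from \<open>m\<close> on are excluded together, because the paths competing
  for \<open>min_passage\<close> have no common length bound.\<close>

definition slow_from :: "nat \<Rightarrow> 'a set" where
  "slow_from m = (\<Union>i. slow c (m + i))"

lemma slow_from_measurable [measurable]: "slow_from m \<in> events"
  unfolding slow_from_def by measurable

lemma prob_slow_from: "prob (slow_from m) \<le> 2 * (1 / 4) ^ m"
proof -
  have sg: "summable (\<lambda>i. (1 / 4 :: real) ^ (m + i))"
    unfolding power_add by (intro summable_mult summable_geometric) simp
  have sp: "summable (\<lambda>i. prob (slow c (m + i)))"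
    by (rule summable_comparison_test'[OF sg]) (use prob_slow_le in auto)
  have "prob (slow_from m) \<le> (\<Sum>i. prob (slow c (m + i)))"
    unfolding slow_from_def by (rule finite_measure_subadditive_countably) (use sp in auto)
  also have "\<dots> \<le> (\<Sum>i. (1 / 4) ^ (m + i))"
    by (intro suminf_le prob_slow_le sp sg)
  also have "\<dots> = (1 / 4) ^ m * (4 / 3)"
    unfolding power_add by (subst suminf_mult) (auto simp: suminf_geometric)
  also have "\<dots> \<le> 2 * (1 / 4) ^ m" by simp
  finally show ?thesis .
qed

lemma fast_outside_slow_from:
  assumes "\<omega> \<in> space M - slow_from m" "ws \<in> paths d n" "m \<le> path_length ws"
  shows "c * real (path_length ws) < passage_time t ws \<omega>"
proof -
  have "ws \<in> paths_of_length d (path_length ws)" using assms(2) by (auto simp: paths_def paths_of_length_def)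
  moreover have "\<omega> \<notin> slow c (m + (path_length ws - m))" using assms(1) unfolding slow_from_def by blast
  ultimately show ?thesis using assms by (auto simp: slow_def not_le)
qed

lemma min_passage_ge_outside_slow_from:
  assumes "\<omega> \<in> space M - slow_from n"
  shows "c * real n \<le> min_passage n \<omega>"
  unfolding min_passage_def
proof (rule cINF_greatest)
  fix ws assume ws: "ws \<in> paths d n"
  then have n: "n \<le> path_length ws" by (rule path_length_ge[OF d])
  then have "c * real n \<le> c * real (path_length ws)" using c by simp
  with fast_outside_slow_from[OF assms ws n] show "c * real n \<le> passage_time t ws \<omega>" by linarith
qed simp

text \<open>Two weak consequences of exponential decay: the first leaves an event of probability at
  least 1/2 for the lower bound on the mean, the second supplies error terms of order
  \<open>1 / n\<close>.\<close>

lemma inverse_power_le: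
  assumes "n \<ge> 1"
  shows "2 * (1 / 4 :: real) ^ n \<le> 1 / 2" "2 * (1 / 4 :: real) ^ n \<le> 1 / real n"
proof -
  define x :: real where "x = 2 ^ n"
  have "n \<le> 2 ^ (n - 1)" using assms less_exp[of "n - 1"] by linarith
  then have "real n \<le> 2 ^ (n - 1)" by (metis of_nat_le_iff of_nat_numeral of_nat_power)
  moreover have "2 ^ (n - 1) * 2 = x" using assms by (cases n) (auto simp: x_def)
  ultimately have n: "2 * real n \<le> x" by linarith
  then have x: "2 \<le> x" using assms by linarith
  then have xx: "2 * x \<le> x * x" by simp
  have "x * x = (2 * 2) ^ n" unfolding x_def by (rule power_mult_distrib[symmetric])
  then have four: "2 * (1 / 4 :: real) ^ n = 2 / (x * x)" by (simp add: power_divide)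
  have ge: "4 \<le> x * x" "2 * real n \<le> x * x" using xx n x by linarith+
  have "2 / (x * x) \<le> 2 / 4" using ge(1) by (intro divide_left_mono) auto
  then show "2 * (1 / 4 :: real) ^ n \<le> 1 / 2" unfolding four by simp
  have "2 / (x * x) \<le> 2 / (2 * real n)" using ge assms by (intro divide_left_mono) auto
  then show "2 * (1 / 4 :: real) ^ n \<le> 1 / real n" unfolding four by simp
qed

lemma min_passage_square_integrable: "integrable M (\<lambda>\<omega>. (min_passage n \<omega>)\<^sup>2)"
  by (rule Bochner_Integration.integrable_bound[OF axis_time_square(1)[of 0 n]])
     (use min_passage_nonneg min_passage_le_axis_time in \<open>auto intro!: power_mono\<close>)

lemma min_passage_integrable: "integrable M (min_passage n)"
  by (rule square_integrable_imp_integrable[OF _ min_passage_square_integrable]) simp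

lemma min_passage_upto_square_integrable: "n \<le> k \<Longrightarrow> integrable M (\<lambda>\<omega>. (min_passage_upto n k \<omega>)\<^sup>2)"
  by (rule Bochner_Integration.integrable_bound[OF axis_time_square(1)[of 0 n]])
     (use min_passage_upto_nonneg min_passage_upto_le_axis_time in \<open>auto intro!: power_mono\<close>)

lemma min_passage_upto_integrable: "n \<le> k \<Longrightarrow> integrable M (min_passage_upto n k)"
  by (rule square_integrable_imp_integrable[OF _ min_passage_upto_square_integrable]) simp_all

text \<open>Outside \<open>slow_from n\<close>, an event of probability at least 1/2, the minimum is
  at least \<open>c * n\<close>; elsewhere it is nonnegative. Hence the factor
  \<open>c / 2\<close>.\<close>

lemma min_passage_mean_ge: "n \<ge> 1 \<Longrightarrow> c / 2 * real n \<le> expectation (min_passage n)"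
proof -
  assume n: "n \<ge> 1"
  have "c * real n * (1 / 2) \<le> c * real n * prob (space M - slow_from n)"
    using prob_slow_from[of n] inverse_power_le(1)[OF n] c by (intro mult_left_mono) (auto simp: prob_compl)
  also have "\<dots> = expectation (\<lambda>\<omega>. c * real n * indicator (space M - slow_from n) \<omega>)" by simp
  also have "\<dots> \<le> expectation (min_passage n)"
  proof (rule integral_mono)
    show "integrable M (\<lambda>\<omega>. c * real n * indicator (space M - slow_from n) \<omega>)"
      by (intro integrable_mult_right integrable_real_indicator) (auto simp: emeasure_eq_measure)
    show "c * real n * indicator (space M - slow_from n) \<omega> \<le> min_passage n \<omega>" if "\<omega> \<in> space M" for \<omega>
      using that min_passage_ge_outside_slow_from min_passage_nonneg by (auto simp: indicator_def)
  qed (rule min_passage_integrable)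
  finally show ?thesis by simp
qed

lemma min_passage_mean_le_min_passage_upto: "n \<le> k \<Longrightarrow> expectation (min_passage n) \<le> expectation (min_passage_upto n k)"
  by (intro integral_mono min_passage_integrable min_passage_upto_integrable min_passage_le_min_passage_upto)

lemma min_passage_upto_mean_le: "n \<le> k \<Longrightarrow> expectation (min_passage_upto n k) \<le> (1 + \<mu>) * real n"
  using integral_mono[OF min_passage_upto_integrable axis_time_integrable[of 0 n] min_passage_upto_le_axis_time, of k] axis_time_mean[of 0 n] by simp

text \<open>There are two bad events, cheap paths and an expensive axis, each of probability at most
  \<open>1 / n\<close>. The condition on \<open>C\<close> admits the tail bound and also ensures
  \<open>4 * \<mu> \<le> C\<^sup>2\<close>.\<close>

lemma concentration:
  assumes "n \<ge> 1" "n \<le> k" "C \<ge> 2 * (1 + \<mu>)"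
  shows "prob {\<omega> \<in> space M. c / 2 * real n \<le> min_passage n \<omega> \<and> min_passage n \<omega> \<le> min_passage_upto n k \<omega> \<and> min_passage_upto n k \<omega> \<le> C * real n} \<ge> 1 - 2 / real n"
proof -
  let ?L = "{\<omega> \<in> space M. C * real n \<le> axis_time 0 n \<omega>}"
  have "2 + 2 * \<mu> \<le> C" using assms(3) by simp
  with \<mu>_nonneg have C: "C > 0" by linarith
  have "prob ?L \<le> 4 * \<mu> * real n / (C * real n)\<^sup>2"
    using assms(1,3) by (intro axis_time_tail mult_right_mono) auto
  also have "\<dots> = (4 * \<mu> / C\<^sup>2) / real n" using assms(1) C by (simp add: power2_eq_square)
  also have "\<dots> \<le> 1 / real n"
  proof (rule divide_right_mono)
    have "4 * \<mu> \<le> (2 * (1 + \<mu>))\<^sup>2" using \<mu>_nonneg by (simp add: power2_eq_square algebra_simps)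
    also have "\<dots> \<le> C\<^sup>2" using assms(3) \<mu>_nonneg by (intro power_mono) auto
    finally show "4 * \<mu> / C\<^sup>2 \<le> 1" using C by (simp add: field_simps)
  qed simp
  finally have "prob (slow_from n \<union> ?L) \<le> 2 / real n"
    using measure_Un_le[of "slow_from n" M ?L] prob_slow_from[of n] inverse_power_le(2)[OF assms(1)] by simp
  then have "1 - 2 / real n \<le> prob (space M - (slow_from n \<union> ?L))" by (subst prob_compl) auto
  also have "\<dots> \<le> prob {\<omega> \<in> space M. c / 2 * real n \<le> min_passage n \<omega> \<and> min_passage n \<omega> \<le> min_passage_upto n k \<omega> \<and> min_passage_upto n k \<omega> \<le> C * real n}"
  proof (rule finite_measure_mono)
    show "space M - (slow_from n \<union> ?L)
      \<subseteq> {\<omega> \<in> space M. c / 2 * real n \<le> min_passage n \<omega> \<and> min_passage n \<omega> \<le> min_passage_upto n k \<omega> \<and> min_passage_upto n k \<omega> \<le> C * real n}"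
    proof
      fix \<omega> assume \<omega>: "\<omega> \<in> space M - (slow_from n \<union> ?L)"
      \<comment> \<open>The pathwise bound holds with \<open>c\<close>; the weaker
        \<open>c / 2\<close> lets one constant serve the mean as well.\<close>
      have "c / 2 * real n \<le> c * real n" using c by simp
      then show "\<omega> \<in> {\<omega> \<in> space M. c / 2 * real n \<le> min_passage n \<omega> \<and> min_passage n \<omega> \<le> min_passage_upto n k \<omega> \<and> min_passage_upto n k \<omega> \<le> C * real n}"
        using \<omega> min_passage_ge_outside_slow_from[of \<omega> n] min_passage_le_min_passage_upto[OF assms(2), of \<omega>] min_passage_upto_le_axis_time[OF assms(2), of \<omega>] by auto
    qed
  qed measurable
  finally show ?thesis .
qed

section \<open>Agreement of constrained and unconstrained minima\<close>

text \<open>The summand 1 ensures \<open>n \<le> k\<close> and covers cheap long paths,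
  \<open>2 * (1 + \<mu>) / c\<close> brings \<open>c * k\<close> into the range of the tail bound,
  and \<open>4 * \<mu> / c\<^sup>2\<close> is the Chebyshev constant at that level.\<close>

definition length_const :: real where
  "length_const = 1 + 2 * (1 + \<mu>) / c + 4 * \<mu> / c\<^sup>2"

lemma length_const: "length_const \<ge> 1" "length_const > 0"
proof -
  have "0 \<le> 2 * (1 + \<mu>) / c" "0 \<le> 4 * \<mu> / c\<^sup>2" using \<mu>_nonneg c by auto
  then show "length_const \<ge> 1" "length_const > 0" unfolding length_const_def by linarith+
qed

text \<open>Disagreement yields a path longer than \<open>k\<close> that costs less than the axis.
  Outside \<open>slow_from k\<close> it costs more than \<open>c * k\<close>, so the axis time
  exceeds \<open>c * k\<close>, far above its mean.\<close>

lemma prob_min_passage_neq: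
  assumes n: "n \<ge> 1" and k: "real k \<ge> length_const * real n"
  shows "prob {\<omega> \<in> space M. min_passage n \<omega> \<noteq> min_passage_upto n k \<omega>} \<le> length_const / real k"
proof -
  have "1 * real n \<le> length_const * real n" using length_const by (intro mult_right_mono) auto
  with k have nk: "n \<le> k" by simp
  then have k0: "real k > 0" using n by simp
  let ?L = "{\<omega> \<in> space M. c * real k \<le> axis_time 0 n \<omega>}"
  have "2 * (1 + \<mu>) / c \<le> length_const" using \<mu>_nonneg unfolding length_const_def by simp
  then have "2 * (1 + \<mu>) \<le> c * length_const" using c by (simp add: field_simps)
  then have "2 * (1 + \<mu>) * real n \<le> c * length_const * real n" by (intro mult_right_mono) auto
  also have "\<dots> \<le> c * real k" using k c by (simp add: mult.assoc)
  finally have "prob ?L \<le> 4 * \<mu> * real n / (c * real k)\<^sup>2" by (rule axis_time_tail[OF n])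
  also have "\<dots> \<le> 4 * \<mu> * real k / (c * real k)\<^sup>2"
    using nk \<mu>_nonneg by (intro divide_right_mono mult_left_mono) auto
  also have "\<dots> = (4 * \<mu> / c\<^sup>2) / real k" using k0 c by (simp add: power2_eq_square)
  finally have L: "prob ?L \<le> (4 * \<mu> / c\<^sup>2) / real k" .
  have "prob {\<omega> \<in> space M. min_passage n \<omega> \<noteq> min_passage_upto n k \<omega>} \<le> prob (slow_from k \<union> ?L)"
  proof (rule finite_measure_mono)
    show "{\<omega> \<in> space M. min_passage n \<omega> \<noteq> min_passage_upto n k \<omega>} \<subseteq> slow_from k \<union> ?L"
    proof (rule subsetI, rule ccontr)
      fix \<omega> assume "\<omega> \<in> {\<omega> \<in> space M. min_passage n \<omega> \<noteq> min_passage_upto n k \<omega>}" and no: "\<omega> \<notin> slow_from k \<union> ?L"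
      then have \<omega>: "\<omega> \<in> space M" "min_passage n \<omega> \<noteq> min_passage_upto n k \<omega>" by auto
      from min_passage_neqD[OF nk \<omega>(2)] obtain ws where ws: "ws \<in> paths d n" "k < path_length ws"
        "passage_time t ws \<omega> < axis_time 0 n \<omega>" by blast
      have "c * real k \<le> c * real (path_length ws)" using ws c by simp
      moreover have "c * real (path_length ws) < passage_time t ws \<omega>"
        using fast_outside_slow_from[of \<omega> k ws n] ws no \<omega> by auto
      ultimately show False using ws(3) no \<omega> by auto
    qed
  qed measurable
  also have "\<dots> \<le> 1 / real k + (4 * \<mu> / c\<^sup>2) / real k"
    using measure_Un_le[of "slow_from k" M ?L] prob_slow_from[of k] inverse_power_le(2)[of k] L n nk by simp
  also have "\<dots> = (1 + 4 * \<mu> / c\<^sup>2) / real k" by (simp add: add_divide_distrib)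
  also have "\<dots> \<le> length_const / real k"
    using \<mu>_nonneg c by (intro divide_right_mono) (auto simp: length_const_def)
  finally show ?thesis .
qed

end

section \<open>Linear variance\<close>

context first_passage_speed begin

text \<open>\<open>\<mu>\<close> times a bound for the mean length of the minimiser per unit of
  \<open>n\<close>: \<open>(1 + \<mu>) / c\<close> stems from its passage time, 2 from exceptionally
  cheap paths.\<close>

definition variance_const :: real where
  "variance_const = \<mu> * ((1 + \<mu>) / c + 2)"

lemma variance_const_nonneg: "0 \<le> variance_const"
  using \<mu>_nonneg c by (simp add: variance_const_def)

text \<open>Bounding the factor \<open>r\<close> by \<open>2 ^ r\<close> still leaves a geometric
  series, with a sum that does not depend on \<open>k\<close>.\<close>

lemma sum_slow: "(\<Sum>r\<le>k. real r * prob (slow c r)) \<le> 2"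
proof -
  have "(\<Sum>r\<le>k. real r * prob (slow c r)) \<le> (\<Sum>r\<le>k. (1 / 2) ^ r)"
  proof (rule sum_mono)
    fix r
    have "real r \<le> 2 ^ r" using less_exp[of r] by (metis less_imp_le of_nat_le_iff of_nat_numeral of_nat_power)
    then have "real r * prob (slow c r) \<le> 2 ^ r * (1 / 4) ^ r"
      by (intro mult_mono prob_slow_le) auto
    also have "\<dots> = (2 * (1 / 4)) ^ r" by (rule power_mult_distrib[symmetric])
    finally show "real r * prob (slow c r) \<le> (1 / 2) ^ r" by simp
  qed
  also have "\<dots> \<le> (\<Sum>r. (1 / 2) ^ r)"
    by (rule sum_le_suminf) (auto intro: summable_geometric)
  also have "\<dots> = 2" by (simp add: suminf_geometric)
  finally show ?thesis .
qed

text \<open>Paths of length at most \<open>k\<close> use finitely many edges, and by independence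
  the weights on them have a product law; the minimum is thus a function on a finite product space,
  to which \<open>efron_stein\<close> applies. The resulting bound depends on neither
  \<open>k\<close> nor \<open>L\<close>.\<close>

lemma variance_truncated_min_passage_upto:
  assumes n: "n \<ge> 1" and nk: "n \<le> k" and L: "0 \<le> L"
  shows "variance (\<lambda>\<omega>. min L (min_passage_upto n k \<omega>)) \<le> variance_const * real n"
proof -
  define P where "P = paths_upto d n k"
  define E where "E = (\<Union>ws\<in>P. path_edges ws)"
  have finP: "finite P" and P0: "P \<noteq> {}"
    unfolding P_def using finite_paths_upto[OF d] paths_upto_nonempty[OF nk] by auto
  have path: "is_path d ws" "distinct ws" if "ws \<in> P" for ws
    using that by (auto simp: P_def paths_upto_def is_path_def)
  have finE: "finite E" using finP by (simp add: E_def)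
  have subE: "E \<subseteq> edges d" unfolding E_def by (intro UN_least path_edges_subset path(1))
  have "path_edges (straight n) \<noteq> {}" using n by (simp add: path_edges_def lessThan_empty_iff)
  then have E0: "E \<noteq> {}" unfolding E_def P_def using straight_in_paths_upto[OF d nk] by auto
  \<comment> \<open>\<open>efron_stein\<close> asks for a probability measure at every index, so a
    point mass is placed off \<open>E\<close>.\<close>
  define N where "N e = (if e \<in> E then distr M borel (t e) else return borel 0)" for e
  have tm[measurable]: "t e \<in> borel_measurable M" if "e \<in> E" for e
    using t_measurable subE that by auto
  have N: "prob_space (N e)" for e
    unfolding N_def by (auto intro!: prob_space_distr prob_space_return tm)
  have setsN: "sets (PiM E N) = sets (PiM E (\<lambda>_. borel))"
    by (intro sets_PiM_cong) (auto simp: N_def)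
  define X where "X \<omega> = (\<lambda>e\<in>E. t e \<omega>)" for \<omega>
  have X[measurable]: "X \<in> measurable M (PiM E (\<lambda>_. borel))"
    unfolding X_def by measurable
  have distr: "distr M (PiM E (\<lambda>_. borel)) X = PiM E N"
  proof -
    have "distr M (PiM E (\<lambda>_. borel)) X = PiM E (\<lambda>e. distr M borel (t e))"
      unfolding X_def
      by (rule indep_vars_iff_distr_eq_PiM'[OF E0 tm, THEN iffD1]) (auto intro: indep_vars_subset[OF indep subE])
    also have "\<dots> = PiM E N" by (intro PiM_cong) (auto simp: N_def)
    finally show ?thesis .
  qed
  have integral_X: "(\<integral>x. g x \<partial>PiM E N) = expectation (\<lambda>\<omega>. g (X \<omega>))"
    if "g \<in> borel_measurable (PiM E N)" for g :: "_ \<Rightarrow> real"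
    unfolding distr[symmetric] using that setsN by (intro integral_distr[OF X]) (simp cong: measurable_cong_sets)
  \<comment> \<open>The absolute values keep the infimum nonnegative on the whole product space.\<close>
  define F where "F x = (INF ws\<in>P. \<Sum>e\<in>path_edges ws. \<bar>x e\<bar>)" for x :: "_ \<Rightarrow> real"
  define f where "f x = min L (F x)" for x
  have F_le: "F x \<le> (\<Sum>e\<in>path_edges ws. \<bar>x e\<bar>)" if "ws \<in> P" for ws x
    unfolding F_def using that by (intro cINF_lower bdd_belowI2[of _ 0]) auto
  have F_nonneg: "0 \<le> F x" for x
    unfolding F_def using P0 by (intro cINF_greatest) auto
  have fL: "\<bar>f x\<bar> \<le> L" for x using F_nonneg[of x] L by (simp add: f_def)
  have [measurable]: "(\<lambda>x. x e) \<in> borel_measurable (PiM E N)" if "e \<in> E" for e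
    using measurable_component_singleton[OF that, of "\<lambda>_. borel"] setsN by (simp cong: measurable_cong_sets)
  have [measurable]: "F \<in> borel_measurable (PiM E N)"
    unfolding F_def
  proof (intro borel_measurable_cINF_real countable_finite finP borel_measurable_sum)
    fix ws e assume "ws \<in> P" "e \<in> path_edges ws"
    then have "e \<in> E" by (auto simp: E_def)
    then show "(\<lambda>x. \<bar>x e\<bar>) \<in> borel_measurable (PiM E N)" by measurable
  qed
  have f[measurable]: "f \<in> borel_measurable (PiM E N)" unfolding f_def by measurable
  have sum_X: "(\<Sum>e\<in>path_edges ws. \<bar>X \<omega> e\<bar>) = passage_time t ws \<omega>" if "ws \<in> P" for ws \<omega>
  proof -
    have "(\<Sum>e\<in>path_edges ws. \<bar>X \<omega> e\<bar>) = (\<Sum>e\<in>path_edges ws. t e \<omega>)"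
      using that nonneg by (intro sum.cong) (auto simp: X_def E_def)
    then show ?thesis by (simp add: passage_time_eq_sum[OF path(2)[OF that]])
  qed
  have F_X: "F (X \<omega>) = min_passage_upto n k \<omega>" for \<omega>
    unfolding F_def min_passage_upto_def P_def[symmetric] using sum_X by (intro INF_cong) auto
  define V where "V e x = (\<integral>y. (max 0 (f (x(e := y)) - f x))\<^sup>2 \<partial>N e)" for e x
  have Vm: "V e \<in> borel_measurable (PiM E N)" if "e \<in> E" for e
    unfolding V_def by (rule measurable_resampled_variation[OF N f that])
  have VX[measurable]: "(\<lambda>\<omega>. V e (X \<omega>)) \<in> borel_measurable M" if "e \<in> E" for e
    using measurable_compose[OF X, of "V e"] Vm[OF that] setsN by (simp cong: measurable_cong_sets)
  have Vb: "\<bar>V e x\<bar> \<le> (2 * L)\<^sup>2" for e x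
    unfolding V_def
  proof (rule prob_space.abs_expectation_le[OF N])
    fix y show "\<bar>(max 0 (f (x(e := y)) - f x))\<^sup>2\<bar> \<le> (2 * L)\<^sup>2"
      using fL[of x] fL[of "x(e := y)"] power_mono[of "max 0 (f (x(e := y)) - f x)" "2 * L" 2]
      by (simp del: power_mult_distrib fun_upd_apply)
  qed
  have Vi: "integrable M (\<lambda>\<omega>. V e (X \<omega>))" if "e \<in> E" for e
    by (rule integrable_bounded[OF VX[OF that] Vb])
  \<comment> \<open>Resampling one edge can raise the minimum only if that edge lies on the minimising path, and then by at most
    the new edge weight.\<close>
  have pointwise: "(\<Sum>e\<in>E. V e (X \<omega>)) \<le> \<mu> * (min_passage_upto n k \<omega> / c + (\<Sum>r\<le>k. real r * indicator (slow c r) \<omega>))"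
    if \<omega>: "\<omega> \<in> space M" for \<omega>
  proof -
    obtain ws where ws: "ws \<in> P" and opt: "min_passage_upto n k \<omega> = passage_time t ws \<omega>"
      using min_passage_upto_attained[OF nk, of \<omega>] by (auto simp: P_def)
    have wsE: "path_edges ws \<subseteq> E" using ws by (auto simp: E_def)
    let ?x = "X \<omega>"
    have V_le: "V e ?x \<le> \<mu> * indicator (path_edges ws) e" if e: "e \<in> E" for e
    proof -
      have *: "F (?x(e := y)) \<le> F ?x + indicator (path_edges ws) e * \<bar>y\<bar>" for y
      proof -
        have "F (?x(e := y)) \<le> (\<Sum>e'\<in>path_edges ws. \<bar>(?x(e := y)) e'\<bar>)" by (rule F_le[OF ws])
        also have "\<dots> \<le> (\<Sum>e'\<in>path_edges ws. \<bar>?x e'\<bar> + (if e' = e then \<bar>y\<bar> else 0))"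
          by (intro sum_mono) auto
        also have "\<dots> = F ?x + indicator (path_edges ws) e * \<bar>y\<bar>"
          by (auto simp: sum.distrib sum.delta sum_X[OF ws] F_X opt indicator_def)
        finally show ?thesis .
      qed
      have sq: "(max 0 (f (?x(e := y)) - f ?x))\<^sup>2 \<le> indicator (path_edges ws) e * y\<^sup>2" for y
      proof -
        \<comment> \<open>Truncation at \<open>L\<close> is monotone and 1-Lipschitz, so it does not
          enlarge an increase of \<open>F\<close>.\<close>
        have "max 0 (f (?x(e := y)) - f ?x) \<le> indicator (path_edges ws) e * \<bar>y\<bar>"
        proof -
          have "0 \<le> indicator (path_edges ws) e * \<bar>y\<bar>" by (auto simp: indicator_def)
          then show ?thesis using *[of y] unfolding f_def by linarith
        qed
        then have "(max 0 (f (?x(e := y)) - f ?x))\<^sup>2 \<le> (indicator (path_edges ws) e * \<bar>y\<bar>)\<^sup>2"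
          by (intro power_mono) auto
        moreover have "(indicator (path_edges ws) e * \<bar>y\<bar>)\<^sup>2 = indicator (path_edges ws) e * y\<^sup>2"
          by (simp add: indicator_def)
        ultimately show ?thesis by (simp only:)
      qed
      have Ne: "N e = distr M borel (t e)" using e by (simp add: N_def)
      have t2: "integrable M (\<lambda>\<omega>. (t e \<omega>)\<^sup>2)" "expectation (\<lambda>\<omega>. (t e \<omega>)\<^sup>2) \<le> \<mu>"
        using e subE t2_integrable t2_le by auto
      have iy: "integrable (N e) (\<lambda>y. y\<^sup>2)" and ey: "(\<integral>y. y\<^sup>2 \<partial>N e) \<le> \<mu>"
        unfolding Ne using t2 tm[OF e] by (auto simp: integrable_distr_eq integral_distr)
      have "V e ?x \<le> (\<integral>y. indicator (path_edges ws) e * y\<^sup>2 \<partial>N e)"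
        unfolding V_def using iy sq by (intro integral_mono') (auto simp: indicator_def)
      also have "\<dots> \<le> \<mu> * indicator (path_edges ws) e" using ey by (simp add: indicator_def)
      finally show ?thesis .
    qed
    have "(\<Sum>e\<in>E. V e ?x) \<le> (\<Sum>e\<in>E. \<mu> * indicator (path_edges ws) e)" by (intro sum_mono V_le)
    also have "\<dots> = \<mu> * real (card (path_edges ws))"
    proof -
      have "(\<Sum>e\<in>E. \<mu> * indicator (path_edges ws) e) = (\<Sum>e\<in>path_edges ws. \<mu>)"
        using finE wsE by (intro sum.mono_neutral_cong_right) auto
      then show ?thesis by simp
    qed
    also have "card (path_edges ws) = path_length ws" by (rule card_path_edges[OF path(2)[OF ws]])
    \<comment> \<open>The length of the minimiser is random, so its exceptional event is absorbed by
      the sum over all \<open>r \<le> k\<close>; otherwise the length is at most the passage time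
      divided by \<open>c\<close>.\<close>
    also have "real (path_length ws) \<le> min_passage_upto n k \<omega> / c + (\<Sum>r\<le>k. real r * indicator (slow c r) \<omega>)"
    proof (cases "\<omega> \<in> slow c (path_length ws)")
      case True
      have k: "path_length ws \<le> k" using ws by (auto simp: P_def paths_upto_def)
      have "real (path_length ws) = real (path_length ws) * indicator (slow c (path_length ws)) \<omega>"
        using True by simp
      also have "\<dots> \<le> (\<Sum>r\<le>k. real r * indicator (slow c r) \<omega>)"
        using k by (intro member_le_sum[where f = "\<lambda>r. real r * indicator (slow c r) \<omega>"]) auto
      also have "\<dots> \<le> min_passage_upto n k \<omega> / c + (\<Sum>r\<le>k. real r * indicator (slow c r) \<omega>)"
        using min_passage_upto_nonneg[OF nk, of \<omega>] c by simp
      finally show ?thesis .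
    next
      case False
      have "ws \<in> paths_of_length d (path_length ws)"
        using ws by (auto simp: P_def paths_upto_def paths_of_length_def)
      with False \<omega> have "c * real (path_length ws) \<le> min_passage_upto n k \<omega>" by (auto simp: slow_def opt not_le)
      then have "real (path_length ws) \<le> min_passage_upto n k \<omega> / c" using c by (simp add: field_simps)
      also have "\<dots> \<le> min_passage_upto n k \<omega> / c + (\<Sum>r\<le>k. real r * indicator (slow c r) \<omega>)"
        by (simp add: sum_nonneg)
      finally show ?thesis .
    qed
    finally show ?thesis using \<mu>_nonneg by (simp add: mult_left_mono)
  qed
  have int_slow: "integrable M (\<lambda>\<omega>. indicator (slow c r) \<omega> :: real)" for r
    by (intro integrable_real_indicator) (auto simp: emeasure_eq_measure)
  define Z where "Z \<omega> = (\<Sum>r\<le>k. real r * indicator (slow c r) \<omega>)" for \<omega>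
  have Z: "integrable M Z" "expectation Z = (\<Sum>r\<le>k. real r * prob (slow c r))"
  proof -
    show "integrable M Z"
      unfolding Z_def by (intro Bochner_Integration.integrable_sum integrable_mult_right int_slow)
    have "expectation Z = (\<Sum>r\<le>k. expectation (\<lambda>\<omega>. real r * indicator (slow c r) \<omega>))"
      unfolding Z_def by (intro Bochner_Integration.integral_sum integrable_mult_right int_slow)
    then show "expectation Z = (\<Sum>r\<le>k. real r * prob (slow c r))" by simp
  qed
  have int_min: "integrable M (\<lambda>\<omega>. min L (min_passage_upto n k \<omega>))" "integrable M (\<lambda>\<omega>. (min L (min_passage_upto n k \<omega>))\<^sup>2)"
  proof -
    have "\<bar>min L (min_passage_upto n k \<omega>)\<bar> \<le> L" "\<bar>(min L (min_passage_upto n k \<omega>))\<^sup>2\<bar> \<le> L\<^sup>2" for \<omega>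
      using min_passage_upto_nonneg[OF nk, of \<omega>] L by (auto intro!: power_mono)
    then show "integrable M (\<lambda>\<omega>. min L (min_passage_upto n k \<omega>))" "integrable M (\<lambda>\<omega>. (min L (min_passage_upto n k \<omega>))\<^sup>2)"
      by (auto intro!: integrable_bounded)
  qed
  have "variance (\<lambda>\<omega>. min L (min_passage_upto n k \<omega>)) = (\<integral>x. (f x)\<^sup>2 \<partial>PiM E N) - (\<integral>x. f x \<partial>PiM E N)\<^sup>2"
    unfolding variance_eq[OF int_min] by (subst (1 2) integral_X) (auto simp: f_def F_X)
  also have "\<dots> \<le> (\<Sum>e\<in>E. \<integral>x. V e x \<partial>PiM E N)"
    unfolding V_def by (rule efron_stein[OF N finE f fL])
  also have "\<dots> = (\<Sum>e\<in>E. expectation (\<lambda>\<omega>. V e (X \<omega>)))"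
    by (intro sum.cong refl integral_X Vm)
  also have "\<dots> = expectation (\<lambda>\<omega>. \<Sum>e\<in>E. V e (X \<omega>))"
    by (rule Bochner_Integration.integral_sum[symmetric]) (rule Vi)
  also have "\<dots> \<le> expectation (\<lambda>\<omega>. \<mu> * (min_passage_upto n k \<omega> / c + Z \<omega>))"
    using Vi min_passage_upto_integrable[OF nk] Z(1) pointwise[folded Z_def]
    by (intro integral_mono Bochner_Integration.integrable_sum integrable_mult_right
          Bochner_Integration.integrable_add integrable_divide) auto
  also have "\<dots> = \<mu> * (expectation (min_passage_upto n k) / c + (\<Sum>r\<le>k. real r * prob (slow c r)))"
    using min_passage_upto_integrable[OF nk] Z by simp
  also have "\<dots> \<le> \<mu> * ((1 + \<mu>) * real n / c + 2)"
    using min_passage_upto_mean_le[OF nk] sum_slow[of k] c \<mu>_nonneg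
    by (intro mult_left_mono add_mono divide_right_mono) auto
  also have "\<dots> \<le> \<mu> * ((1 + \<mu>) * real n / c + 2 * real n)"
    using n \<mu>_nonneg by (intro mult_left_mono add_left_mono) auto
  also have "\<dots> = variance_const * real n" by (simp add: variance_const_def algebra_simps)
  finally show ?thesis .
qed

lemma variance_min_passage_upto:
  assumes "n \<ge> 1" "n \<le> k"
  shows "variance (min_passage_upto n k) \<le> variance_const * real n"
proof (rule variance_le_lim[where X = "\<lambda>L \<omega>. min (real L) (min_passage_upto n k \<omega>)" and g = "axis_time 0 n"])
  show "(\<lambda>L. min (real L) (min_passage_upto n k \<omega>)) \<longlonglongrightarrow> min_passage_upto n k \<omega>" for \<omega>
  proof (rule tendsto_eventually)
    show "\<forall>\<^sub>F L in sequentially. min (real L) (min_passage_upto n k \<omega>) = min_passage_upto n k \<omega>"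
      using eventually_ge_at_top[of "nat \<lceil>min_passage_upto n k \<omega>\<rceil>"] by eventually_elim linarith
  qed
  show "\<bar>min (real L) (min_passage_upto n k \<omega>)\<bar> \<le> axis_time 0 n \<omega>" for L \<omega>
    using min_passage_upto_nonneg[OF assms(2), of \<omega>] min_passage_upto_le_axis_time[OF assms(2), of \<omega>] by simp
qed (use variance_truncated_min_passage_upto[OF assms] axis_time_square(1) in auto)

lemma variance_min_passage: "n \<ge> 1 \<Longrightarrow> variance (min_passage n) \<le> variance_const * real n"
  by (rule variance_le_lim[where X = "\<lambda>k. min_passage_upto n (n + k)" and g = "axis_time 0 n", OF _ _ _ min_passage_upto_tendsto])
    (use min_passage_upto_nonneg min_passage_upto_le_axis_time axis_time_square(1) variance_min_passage_upto in auto)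

end

section \<open>Strong laws\<close>

lemma summable_inverse_Suc_square: "summable (\<lambda>j. C / (real (Suc j))\<^sup>2)"
proof -
  have "summable (\<lambda>j. inverse (real (Suc j) ^ 2))"
    using inverse_power_summable[of 2, where 'a = real] by (subst summable_Suc_iff) simp
  from summable_mult[OF this, of C] show ?thesis by (simp add: divide_inverse)
qed

context first_passage_speed begin

lemma axis_time_mono: "n \<le> n' \<Longrightarrow> axis_time m n \<omega> \<le> axis_time m n' \<omega>"
  unfolding axis_time_def by (intro sum_mono2) (auto simp: nonneg)

lemma min_passage_mean_diff_le: "m \<le> n \<Longrightarrow> \<bar>expectation (min_passage n) - expectation (min_passage m)\<bar> \<le> expectation (axis_time m n)"
proof -
  assume mn: "m \<le> n"
  have "\<bar>expectation (min_passage n) - expectation (min_passage m)\<bar> = \<bar>expectation (\<lambda>\<omega>. min_passage n \<omega> - min_passage m \<omega>)\<bar>"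
    using min_passage_integrable by simp
  also have "\<dots> \<le> expectation (\<lambda>\<omega>. \<bar>min_passage n \<omega> - min_passage m \<omega>\<bar>)" by (rule integral_abs_bound)
  also have "\<dots> \<le> expectation (axis_time m n)"
    by (intro integral_mono integrable_abs Bochner_Integration.integrable_diff min_passage_integrable axis_time_integrable min_passage_diff_le[OF mn])
  finally show ?thesis .
qed

text \<open>Along the squares the normalised variance is of order \<open>1 / m j\<close>, hence
  summable. A gap between squares has of order \<open>j\<close> edges, so its normalised axis time
  has second moment of order \<open>1 / j\<^sup>2\<close>, again summable. Fluctuations and gap
  terms therefore both vanish by the same criterion.\<close>

lemma min_passage_lln: "AE \<omega> in M. (\<lambda>n. (min_passage n \<omega> - expectation (min_passage n)) / real n) \<longlonglongrightarrow> 0"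
proof -
  \<comment> \<open>Starting at \<open>Suc j\<close> keeps all denominators positive.\<close>
  define m where "m j = (Suc j)\<^sup>2" for j
  have m: "real (m j) = (real (Suc j))\<^sup>2" "m j > 0" "m j \<le> m (Suc j)" for j
    by (auto simp: m_def power_mono)
  define gap where "gap j = real (m (Suc j) - m j)" for j
  have gap: "gap j \<le> 3 * real (Suc j)" "0 \<le> gap j" for j
    by (simp_all add: gap_def m_def power2_eq_square of_nat_diff)
  define Z where "Z j \<omega> = (min_passage (m j) \<omega> - expectation (min_passage (m j))) / real (m j)" for j \<omega>
  define R where "R j \<omega> = axis_time (m j) (m (Suc j)) \<omega> / real (m j)" for j \<omega>
  have Z: "AE \<omega> in M. (\<lambda>j. Z j \<omega>) \<longlonglongrightarrow> 0"
  proof (rule AE_tendsto_zero_of_summable[OF _ _ summable_inverse_Suc_square[of variance_const]])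
    fix j
    have sq: "(Z j \<omega>)\<^sup>2 = (min_passage (m j) \<omega> - expectation (min_passage (m j)))\<^sup>2 / (real (m j))\<^sup>2" for \<omega>
      by (simp add: Z_def power_divide)
    have "integrable M (\<lambda>\<omega>. (min_passage (m j) \<omega> - expectation (min_passage (m j)))\<^sup>2)"
      unfolding power2_diff using min_passage_square_integrable min_passage_integrable by simp
    then show "integrable M (\<lambda>\<omega>. (Z j \<omega>)\<^sup>2)" unfolding sq by simp
    have "expectation (\<lambda>\<omega>. (Z j \<omega>)\<^sup>2) = variance (min_passage (m j)) / (real (m j))\<^sup>2" unfolding sq by simp
    also have "\<dots> \<le> variance_const * real (m j) / (real (m j))\<^sup>2"
      using m(2)[of j] by (intro divide_right_mono variance_min_passage) auto
    also have "\<dots> = variance_const / (real (Suc j))\<^sup>2" using m(2)[of j] by (simp add: m(1) power2_eq_square)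
    finally show "expectation (\<lambda>\<omega>. (Z j \<omega>)\<^sup>2) \<le> variance_const / (real (Suc j))\<^sup>2" .
  qed
  have R: "AE \<omega> in M. (\<lambda>j. R j \<omega>) \<longlonglongrightarrow> 0"
  proof (rule AE_tendsto_zero_of_summable[OF _ _ summable_inverse_Suc_square[of "9 * \<mu>"]])
    fix j
    have sq: "(R j \<omega>)\<^sup>2 = (axis_time (m j) (m (Suc j)) \<omega>)\<^sup>2 / (real (m j))\<^sup>2" for \<omega>
      by (simp add: R_def power_divide)
    show "integrable M (\<lambda>\<omega>. (R j \<omega>)\<^sup>2)" unfolding sq using axis_time_square(1) by simp
    have "expectation (\<lambda>\<omega>. (R j \<omega>)\<^sup>2) = expectation (\<lambda>\<omega>. (axis_time (m j) (m (Suc j)) \<omega>)\<^sup>2) / (real (m j))\<^sup>2"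
      unfolding sq by simp
    also have "\<dots> \<le> \<mu> * (gap j)\<^sup>2 / (real (m j))\<^sup>2"
      unfolding gap_def by (intro divide_right_mono axis_time_second_moment) auto
    also have "\<dots> \<le> \<mu> * (3 * real (Suc j))\<^sup>2 / (real (m j))\<^sup>2"
      using gap[of j] \<mu>_nonneg by (intro divide_right_mono mult_left_mono power_mono) auto
    also have "\<dots> = 9 * \<mu> / (real (Suc j))\<^sup>2"
    proof -
      have "\<mu> * (3 * a)\<^sup>2 / (a\<^sup>2)\<^sup>2 = 9 * \<mu> / a\<^sup>2" if "a > 0" for a :: real
        using that by (simp add: power2_eq_square)
      from this[of "real (Suc j)"] show ?thesis unfolding m(1) by simp
    qed
    finally show "expectation (\<lambda>\<omega>. (R j \<omega>)\<^sup>2) \<le> 9 * \<mu> / (real (Suc j))\<^sup>2" .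
  qed
  \<comment> \<open>Changing the target also shifts the centring, by at most the mean axis time of
    the gap.\<close>
  have ER_le: "expectation (R j) \<le> 3 * (1 + \<mu>) / real (Suc j)" for j
  proof -
    have "expectation (R j) = expectation (axis_time (m j) (m (Suc j))) / real (m j)"
      by (simp add: R_def[abs_def])
    also have "\<dots> \<le> (1 + \<mu>) * gap j / real (m j)"
      unfolding gap_def by (intro divide_right_mono axis_time_mean) auto
    also have "\<dots> \<le> (1 + \<mu>) * (3 * real (Suc j)) / real (m j)"
      using gap[of j] \<mu>_nonneg by (intro divide_right_mono mult_left_mono) auto
    also have "\<dots> = 3 * (1 + \<mu>) / real (Suc j)"
    proof -
      have "(1 + \<mu>) * (3 * a) / a\<^sup>2 = 3 * (1 + \<mu>) / a" if "a > 0" for a :: real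
        using that by (simp add: power2_eq_square)
      from this[of "real (Suc j)"] show ?thesis unfolding m(1) by simp
    qed
    finally show ?thesis .
  qed
  have ER: "(\<lambda>j. 3 * (1 + \<mu>) / real (Suc j)) \<longlonglongrightarrow> 0"
    by (rule LIMSEQ_Suc[OF lim_const_over_n])
  \<comment> \<open>Index of the last square not exceeding \<open>n\<close>; for
    \<open>n \<ge> 1\<close> the subtraction is exact and
    \<open>Suc (J n) = floor_sqrt n\<close>.\<close>
  define J where "J n = floor_sqrt n - 1" for n
  have J: "filterlim J at_top sequentially"
    unfolding filterlim_at_top
  proof
    fix B
    show "\<forall>\<^sub>F n in sequentially. B \<le> J n"
      using eventually_ge_at_top[of "(Suc B)\<^sup>2"]
    proof eventually_elim
      case (elim n)
      then have "Suc B \<le> floor_sqrt n" by (rule le_floor_sqrtI)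
      then show ?case by (simp add: J_def)
    qed
  qed
  have bound: "\<bar>(min_passage n \<omega> - expectation (min_passage n)) / real n\<bar> \<le> \<bar>Z (J n) \<omega>\<bar> + R (J n) \<omega> + 3 * (1 + \<mu>) / real (Suc (J n))"
    if "n \<ge> 1" for n \<omega>
  proof -
    define j where "j = J n"
    have "Suc j = floor_sqrt n" using that by (simp add: j_def J_def Suc_leI)
    then have low: "m j \<le> n" and up: "n \<le> m (Suc j)"
      using floor_sqrt_power2_le[of n] Suc_floor_sqrt_power2_gt[of n] by (simp_all add: m_def)
    have SS: "axis_time (m j) n \<omega>' \<le> axis_time (m j) (m (Suc j)) \<omega>'" for \<omega>' by (rule axis_time_mono[OF up])
    have "\<bar>min_passage n \<omega> - min_passage (m j) \<omega>\<bar> \<le> axis_time (m j) (m (Suc j)) \<omega>"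
      using min_passage_diff_le[OF low, of \<omega>] SS[of \<omega>] by linarith
    moreover have "\<bar>expectation (min_passage n) - expectation (min_passage (m j))\<bar> \<le> expectation (axis_time (m j) (m (Suc j)))"
      using min_passage_mean_diff_le[OF low] integral_mono[OF axis_time_integrable axis_time_integrable SS] by (rule order_trans)
    ultimately have "\<bar>min_passage n \<omega> - expectation (min_passage n)\<bar> \<le> \<bar>min_passage (m j) \<omega> - expectation (min_passage (m j))\<bar>
        + axis_time (m j) (m (Suc j)) \<omega> + expectation (axis_time (m j) (m (Suc j)))" by linarith
    also have "\<dots> = (\<bar>Z j \<omega>\<bar> + R j \<omega> + expectation (R j)) * real (m j)"
      using m(2)[of j] by (simp add: Z_def R_def[abs_def] algebra_simps)
    also have "\<dots> \<le> (\<bar>Z j \<omega>\<bar> + R j \<omega> + expectation (R j)) * real n"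
    proof (rule mult_left_mono)
      have "0 \<le> R j \<omega>'" for \<omega>' using axis_time_nonneg by (simp add: R_def)
      then show "0 \<le> \<bar>Z j \<omega>\<bar> + R j \<omega> + expectation (R j)" by simp
    qed (use low in simp)
    finally have "\<bar>(min_passage n \<omega> - expectation (min_passage n)) / real n\<bar> \<le> \<bar>Z j \<omega>\<bar> + R j \<omega> + expectation (R j)"
      using that by (simp add: abs_divide divide_le_eq)
    with ER_le[of j] show ?thesis by (simp add: j_def)
  qed
  from Z R show ?thesis
  proof eventually_elim
    case (elim \<omega>)
    have "(\<lambda>j. \<bar>Z j \<omega>\<bar> + R j \<omega> + 3 * (1 + \<mu>) / real (Suc j)) \<longlonglongrightarrow> \<bar>0\<bar> + 0 + 0"
      by (intro tendsto_add tendsto_rabs elim ER)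
    then have "(\<lambda>j. \<bar>Z j \<omega>\<bar> + R j \<omega> + 3 * (1 + \<mu>) / real (Suc j)) \<longlonglongrightarrow> 0" by simp
    from filterlim_compose[OF this J] show ?case
    proof (rule Lim_null_comparison[rotated])
      show "\<forall>\<^sub>F n in sequentially. norm ((min_passage n \<omega> - expectation (min_passage n)) / real n)
          \<le> \<bar>Z (J n) \<omega>\<bar> + R (J n) \<omega> + 3 * (1 + \<mu>) / real (Suc (J n))"
        using eventually_ge_at_top[of 1] by eventually_elim (use bound in simp)
    qed
  qed
qed

text \<open>The difference lives on the event of disagreement and is at most the axis time
  \<open>S\<close> there. The elementary bound \<open>S \<le> S\<^sup>2 / q + q\<close> separates
  the second moment of \<open>S\<close> from the probability of that event.\<close>

lemma min_passage_upto_mean_diff: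
  assumes n: "n \<ge> 1" and k: "real k \<ge> length_const * real n"
  shows "expectation (min_passage_upto n k) - expectation (min_passage n) \<le> (\<mu> + length_const) * real n / sqrt (real k)"
proof -
  have "1 * real n \<le> length_const * real n" using length_const by (intro mult_right_mono) auto
  with k have nk: "n \<le> k" by simp
  \<comment> \<open>Balances \<open>n\<^sup>2 / q\<close> against \<open>q / k\<close>.\<close>
  define q where "q = real n * sqrt (real k)"
  have q: "q > 0" using n nk by (simp add: q_def)
  let ?B = "{\<omega> \<in> space M. min_passage n \<omega> \<noteq> min_passage_upto n k \<omega>}"
  have iB: "integrable M (\<lambda>\<omega>. indicator ?B \<omega> :: real)"
    by (intro integrable_real_indicator) (auto simp: emeasure_eq_measure)
  have "expectation (min_passage_upto n k) - expectation (min_passage n) = expectation (\<lambda>\<omega>. min_passage_upto n k \<omega> - min_passage n \<omega>)"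
    using min_passage_integrable min_passage_upto_integrable[OF nk] by simp
  also have "\<dots> \<le> expectation (\<lambda>\<omega>. (axis_time 0 n \<omega>)\<^sup>2 / q + q * indicator ?B \<omega>)"
  proof (rule integral_mono)
    show "integrable M (\<lambda>\<omega>. min_passage_upto n k \<omega> - min_passage n \<omega>)" using min_passage_integrable min_passage_upto_integrable[OF nk] by simp
    show "integrable M (\<lambda>\<omega>. (axis_time 0 n \<omega>)\<^sup>2 / q + q * indicator ?B \<omega>)" using axis_time_square(1) iB by simp
    fix \<omega> assume \<omega>: "\<omega> \<in> space M"
    show "min_passage_upto n k \<omega> - min_passage n \<omega> \<le> (axis_time 0 n \<omega>)\<^sup>2 / q + q * indicator ?B \<omega>"
    proof (cases "min_passage n \<omega> = min_passage_upto n k \<omega>")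
      case False
      have "min_passage_upto n k \<omega> - min_passage n \<omega> \<le> axis_time 0 n \<omega>" using min_passage_upto_le_axis_time[OF nk, of \<omega>] min_passage_nonneg[of n \<omega>] by linarith
      also have "axis_time 0 n \<omega> \<le> (axis_time 0 n \<omega>)\<^sup>2 / q + q"
      proof -
        have "0 \<le> (axis_time 0 n \<omega> - q)\<^sup>2" by simp
        also have "\<dots> = (axis_time 0 n \<omega>)\<^sup>2 + q\<^sup>2 - 2 * (q * axis_time 0 n \<omega>)" by (simp add: power2_diff)
        finally have "q * axis_time 0 n \<omega> \<le> (axis_time 0 n \<omega>)\<^sup>2 + q\<^sup>2"
          using mult_nonneg_nonneg[OF less_imp_le[OF q] axis_time_nonneg[of 0 n \<omega>]] by linarith
        then show ?thesis using q by (simp add: field_simps power2_eq_square)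
      qed
      finally show ?thesis using False \<omega> by simp
    qed (use q in simp)
  qed
  also have "\<dots> = expectation (\<lambda>\<omega>. (axis_time 0 n \<omega>)\<^sup>2) / q + q * prob ?B"
    using axis_time_square(1) iB by simp
  also have "\<dots> \<le> \<mu> * (real n)\<^sup>2 / q + q * (length_const / real k)"
    using axis_time_second_moment[of 0 n] prob_min_passage_neq[OF n k] q
    by (intro add_mono divide_right_mono mult_left_mono) auto
  also have "\<dots> = (\<mu> + length_const) * real n / sqrt (real k)"
  proof -
    have "\<mu> * (real n)\<^sup>2 / q = \<mu> * real n / sqrt (real k)" using n by (simp add: q_def power2_eq_square)
    moreover have "q * (length_const / real k) = length_const * real n / sqrt (real k)"
    proof -
      have "sqrt (real k) > 0" "real k = sqrt (real k) * sqrt (real k)" using n nk by simp_all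
      moreover have "real n * r * (length_const / (r * r)) = length_const * real n / r" if "r > 0" for r
        using that by simp
      ultimately show ?thesis unfolding q_def by metis
    qed
    ultimately show ?thesis by (simp add: add_divide_distrib algebra_simps)
  qed
  finally show ?thesis .
qed

text \<open>The growth of \<open>k\<close> makes the probabilities of disagreement summable, so
  almost surely the two minima agree for all large \<open>n\<close>. Their means must be compared
  separately, since almost sure agreement does not control the centring.\<close>

lemma min_passage_upto_lln:
  assumes \<epsilon>: "\<epsilon> > 0" and k: "\<And>n. n \<ge> 1 \<Longrightarrow> real (k n) \<ge> real n powr (1 + \<epsilon>)"
  shows "AE \<omega> in M. (\<lambda>n. (min_passage_upto n (k n) \<omega> - expectation (min_passage_upto n (k n))) / real n) \<longlonglongrightarrow> 0"
proof -
  have nk: "n \<le> k n" if "n \<ge> 1" for n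
  proof -
    have "real n = real n powr 1" using that by simp
    also have "\<dots> \<le> real n powr (1 + \<epsilon>)" using that \<epsilon> by (intro powr_mono) auto
    finally show ?thesis using k[OF that] by simp
  qed
  \<comment> \<open>The threshold solves
    \<open>n powr \<epsilon> \<ge> length_const\<close>.\<close>
  have large: "\<forall>\<^sub>F n in sequentially. n \<ge> 1 \<and> length_const * real n \<le> real (k n)"
    using eventually_ge_at_top[of "Suc (nat \<lceil>length_const powr (1 / \<epsilon>)\<rceil>)"]
  proof eventually_elim
    case (elim n)
    then have n: "n \<ge> 1" and "length_const powr (1 / \<epsilon>) \<le> real n" by linarith+
    then have "(length_const powr (1 / \<epsilon>)) powr \<epsilon> \<le> real n powr \<epsilon>" using \<epsilon> by (intro powr_mono2) auto
    then have "length_const \<le> real n powr \<epsilon>" using \<epsilon> length_const by (simp add: powr_powr)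
    then have "length_const * real n \<le> real n powr \<epsilon> * real n" by (intro mult_right_mono) auto
    also have "\<dots> = real n powr (1 + \<epsilon>)" using n by (simp add: powr_add)
    finally show ?case using k[OF n] n by simp
  qed
  let ?B = "\<lambda>n. {\<omega> \<in> space M. min_passage n \<omega> \<noteq> min_passage_upto n (k n) \<omega>}"
  have "summable (\<lambda>n. prob (?B n))"
  proof (rule summable_comparison_test_ev)
    show "summable (\<lambda>n. length_const * real n powr (- (1 + \<epsilon>)))"
      using \<epsilon> by (intro summable_mult) (simp add: summable_real_powr_iff)
    show "\<forall>\<^sub>F n in sequentially. norm (prob (?B n)) \<le> length_const * real n powr (- (1 + \<epsilon>))"
      using large
    proof eventually_elim
      case (elim n)
      then have "prob (?B n) \<le> length_const / real (k n)" by (intro prob_min_passage_neq) auto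
      also have "\<dots> \<le> length_const / (real n powr (1 + \<epsilon>))"
        using elim k[of n] length_const nk[of n] by (intro divide_left_mono) auto
      finally show ?case by (simp only: powr_minus divide_inverse) simp
    qed
  qed
  then have ev: "AE \<omega> in M. \<forall>\<^sub>F n in sequentially. \<omega> \<in> space M - ?B n"
    by (intro borel_cantelli_AE1) (auto simp: emeasure_eq_measure)
  have "(\<lambda>n. (expectation (min_passage n) - expectation (min_passage_upto n (k n))) / real n) \<longlonglongrightarrow> 0"
  proof (rule Lim_null_comparison)
    show "(\<lambda>n. (\<mu> + length_const) / sqrt (real n)) \<longlonglongrightarrow> 0"
      by (intro tendsto_divide_0[OF tendsto_const] filterlim_at_top_imp_at_infinity
            filterlim_compose[OF sqrt_at_top filterlim_real_sequentially])
    show "\<forall>\<^sub>F n in sequentially. norm ((expectation (min_passage n) - expectation (min_passage_upto n (k n))) / real n) \<le> (\<mu> + length_const) / sqrt (real n)"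
      using large
    proof eventually_elim
      case (elim n)
      have n: "n \<ge> 1" using elim by simp
      have "norm ((expectation (min_passage n) - expectation (min_passage_upto n (k n))) / real n)
          = (expectation (min_passage_upto n (k n)) - expectation (min_passage n)) / real n"
        using min_passage_mean_le_min_passage_upto[OF nk[OF n]] by (simp add: abs_divide)
      also have "\<dots> \<le> ((\<mu> + length_const) * real n / sqrt (real (k n))) / real n"
        using elim by (intro divide_right_mono min_passage_upto_mean_diff) auto
      also have "\<dots> = (\<mu> + length_const) / sqrt (real (k n))" using n by simp
      also have "\<dots> \<le> (\<mu> + length_const) / sqrt (real n)"
        using n nk[OF n] length_const \<mu>_nonneg by (intro divide_left_mono) auto
      finally show ?case .
    qed
  qed
  note mean = this
  from ev min_passage_lln show ?thesis
  proof eventually_elim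
    case (elim \<omega>)
    have "(\<lambda>n. (min_passage n \<omega> - expectation (min_passage n)) / real n + (expectation (min_passage n) - expectation (min_passage_upto n (k n))) / real n) \<longlonglongrightarrow> 0 + 0"
      by (intro tendsto_add elim(2) mean)
    then have "(\<lambda>n. (min_passage n \<omega> - expectation (min_passage n)) / real n + (expectation (min_passage n) - expectation (min_passage_upto n (k n))) / real n) \<longlonglongrightarrow> 0"
      by simp
    then show ?case
    proof (rule Lim_transform_eventually)
      show "\<forall>\<^sub>F n in sequentially. (min_passage n \<omega> - expectation (min_passage n)) / real n + (expectation (min_passage n) - expectation (min_passage_upto n (k n))) / real n
          = (min_passage_upto n (k n) \<omega> - expectation (min_passage_upto n (k n))) / real n"
        using elim(1) by eventually_elim (auto simp: add_divide_distrib[symmetric])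
    qed
  qed
qed

end

section \<open>Transfer to extended real minima of the original weights\<close>

text \<open>The extended real minima agree with the real ones only off a null set. Measurability of
  \<open>X\<close> is a separate premise because the measure space need not be complete.\<close>

lemma finite_second_moment_mean_var:
  assumes "prob_space M" and X: "X \<in> borel_measurable M" and Y: "Y \<in> borel_measurable M"
    and eq: "AE \<omega> in M. X \<omega> = ereal (Y \<omega>)" and Y2: "integrable M (\<lambda>\<omega>. (Y \<omega>)\<^sup>2)"
  shows "finite_second_moment M X" "mean M X = prob_space.expectation M Y" "var M X = prob_space.variance M Y"
proof -
  interpret prob_space M by fact
  note [measurable] = X Y
  have eq': "AE \<omega> in M. real_of_ereal (X \<omega>) = Y \<omega>" using eq by eventually_elim simp
  show m: "mean M X = expectation Y"
    unfolding mean_def using eq' by (intro integral_cong_AE) auto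
  show "var M X = variance Y"
    unfolding var_def m[unfolded mean_def] using eq' by (intro integral_cong_AE) auto
  have "integrable M (\<lambda>\<omega>. (real_of_ereal (X \<omega>))\<^sup>2)"
    using eq' by (subst integrable_cong_AE[where g = "\<lambda>\<omega>. (Y \<omega>)\<^sup>2"]) (auto simp: Y2)
  moreover have "AE \<omega> in M. \<bar>X \<omega>\<bar> \<noteq> \<infinity>" using eq by eventually_elim simp
  ultimately show "finite_second_moment M X" unfolding finite_second_moment_def using X by simp
qed

theorem theorem3p1:
  fixes M :: "'a measure"
    and d :: nat
    and t :: "(nat \<Rightarrow> int) set \<Rightarrow> 'a \<Rightarrow> real"
  assumes "prob_space M"
    and "d \<ge> 1"
    and "prob_space.indep_vars M (\<lambda>_. borel) t (edges d)"
    and "((\<lambda>\<epsilon>::real. SUP e\<in>edges d. measure M {\<omega> \<in> space M. t e \<omega> \<le> \<epsilon>}) \<longlongrightarrow> 0) (at_right 0)"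
    and "(SUP e\<in>edges d. \<integral>\<^sup>+\<omega>. ennreal ((t e \<omega>)\<^sup>2) \<partial>M) < \<infinity>"
  shows "
    (\<forall>n\<ge>1. finite_second_moment M (min_time d t n) \<and>
        (\<forall>k\<ge>n. finite_second_moment M (min_time_upto d t n k))) \<and>
    (\<exists>C1>0. \<exists>C2>0. \<forall>n\<ge>1. \<forall>k\<ge>n.
        measure M {\<omega> \<in> space M. ereal (C1 * real n) \<le> min_time d t n \<omega> \<and>
            min_time d t n \<omega> \<le> min_time_upto d t n k \<omega> \<and>
            min_time_upto d t n k \<omega> \<le> ereal (C2 * real n)} \<ge> 1 - C2 / real n \<and>
        var M (min_time_upto d t n k) \<le> C2 * real n \<and>
        C1 * real n \<le> mean M (min_time d t n) \<and>
        mean M (min_time d t n) \<le> mean M (min_time_upto d t n k) \<and>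
        mean M (min_time_upto d t n k) \<le> C2 * real n) \<and>
    (\<exists>C3>0. \<forall>n\<ge>1. \<forall>k::nat. real k \<ge> C3 * real n \<longrightarrow>
        measure M {\<omega> \<in> space M. min_time d t n \<omega> \<noteq> min_time_upto d t n k \<omega>} \<le> C3 / real k) \<and>
    (\<forall>k::nat \<Rightarrow> nat. (\<exists>\<epsilon>>0. \<forall>n\<ge>1. real (k n) \<ge> real n powr (1 + \<epsilon>)) \<longrightarrow>
        (AE \<omega> in M. (\<lambda>n. (real_of_ereal (min_time_upto d t n (k n) \<omega>)
            - mean M (min_time_upto d t n (k n))) / real n) \<longlonglongrightarrow> 0) \<and>
        (AE \<omega> in M. (\<lambda>n. (real_of_ereal (min_time d t n \<omega>) - mean M (min_time d t n)) / real n)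
            \<longlonglongrightarrow> 0)) \<and>
    (((\<lambda>m::real. SUP e\<in>edges d.
            \<integral>\<^sup>+\<omega>. ennreal ((t e \<omega>)\<^sup>2) * indicator {\<omega>. t e \<omega> \<ge> m} \<omega> \<partial>M) \<longlongrightarrow> 0) at_top \<longrightarrow>
        (\<lambda>n. var M (\<lambda>\<omega>. min_time d t n \<omega> / ereal (real n))) \<longlonglongrightarrow> 0) \<and>
    ((\<exists>p::real. p > 2 \<and> (SUP e\<in>edges d. \<integral>\<^sup>+\<omega>. ennreal (t e \<omega> powr p) \<partial>M) < \<infinity>) \<longrightarrow>
        (\<exists>C>0. \<forall>n\<ge>1. var M (min_time d t n) \<le> C * real n))"
proof -
  interpret prob_space M by fact
  have tm[measurable]: "t e \<in> borel_measurable M" if "e \<in> edges d" for e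
    using assms(3) that by (auto simp: indep_vars_def)
  have small: "\<exists>\<epsilon>>0. \<forall>e\<in>edges d. prob {\<omega> \<in> space M. t e \<omega> \<le> \<epsilon>} \<le> \<delta>" if "\<delta> > 0" for \<delta>
  proof -
    have "\<forall>\<^sub>F \<epsilon> in at_right 0. (SUP e\<in>edges d. prob {\<omega> \<in> space M. t e \<omega> \<le> \<epsilon>}) < \<delta>"
      using order_tendstoD(2)[OF assms(4) that] .
    then obtain b where b: "b > 0" "\<And>\<epsilon>. \<epsilon> > 0 \<Longrightarrow> \<epsilon> < b \<Longrightarrow> (SUP e\<in>edges d. prob {\<omega> \<in> space M. t e \<omega> \<le> \<epsilon>}) < \<delta>"
      unfolding eventually_at_right_field by auto
    have "prob {\<omega> \<in> space M. t e \<omega> \<le> b / 2} \<le> \<delta>" if "e \<in> edges d" for e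
    proof -
      \<comment> \<open>The supremum is taken in the reals; probabilities are bounded by 1, so it is
        a genuine upper bound.\<close>
      have "prob {\<omega> \<in> space M. t e \<omega> \<le> b / 2} \<le> (SUP e\<in>edges d. prob {\<omega> \<in> space M. t e \<omega> \<le> b / 2})"
        using that by (intro cSUP_upper bdd_aboveI2[of _ _ 1]) auto
      also have "\<dots> < \<delta>" using b(1) by (intro b(2)) auto
      finally show ?thesis by simp
    qed
    then show ?thesis using b(1) by (intro exI[of _ "b / 2"]) auto
  qed
  have AE_nonneg: "AE \<omega> in M. 0 \<le> t e \<omega>" if e: "e \<in> edges d" for e
  proof -
    have [measurable]: "t e \<in> borel_measurable M" by (rule tm[OF e])
    have "prob {\<omega> \<in> space M. t e \<omega> \<le> 0} \<le> \<delta>" if \<delta>: "\<delta> > 0" for \<delta>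
    proof -
      obtain \<epsilon> where "\<epsilon> > 0" and p: "prob {\<omega> \<in> space M. t e \<omega> \<le> \<epsilon>} \<le> \<delta>" using small[OF \<delta>] e by blast
      then have "prob {\<omega> \<in> space M. t e \<omega> \<le> 0} \<le> prob {\<omega> \<in> space M. t e \<omega> \<le> \<epsilon>}"
        by (intro finite_measure_mono) auto
      with p show ?thesis by simp
    qed
    then have "prob {\<omega> \<in> space M. t e \<omega> \<le> 0} = 0"
      by (meson dense_ge measure_nonneg order_antisym)
    then have "AE \<omega> in M. \<omega> \<notin> {\<omega> \<in> space M. t e \<omega> \<le> 0}"
      by (subst (asm) prob_eq_0) auto
    then show ?thesis by (auto elim!: eventually_mono)
  qed
  define \<mu> where "\<mu> = enn2real (SUP e\<in>edges d. \<integral>\<^sup>+\<omega>. ennreal ((t e \<omega>)\<^sup>2) \<partial>M)"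
  have t2: "integrable M (\<lambda>\<omega>. (t e \<omega>)\<^sup>2) \<and> expectation (\<lambda>\<omega>. (t e \<omega>)\<^sup>2) \<le> \<mu>" if e: "e \<in> edges d" for e
  proof -
    have le: "(\<integral>\<^sup>+\<omega>. ennreal ((t e \<omega>)\<^sup>2) \<partial>M) \<le> (SUP e\<in>edges d. \<integral>\<^sup>+\<omega>. ennreal ((t e \<omega>)\<^sup>2) \<partial>M)"
      by (rule SUP_upper[OF e])
    then have fin: "(\<integral>\<^sup>+\<omega>. ennreal ((t e \<omega>)\<^sup>2) \<partial>M) < \<infinity>" using assms(5) by (rule le_less_trans)
    have [measurable]: "t e \<in> borel_measurable M" by (rule tm[OF e])
    have i: "integrable M (\<lambda>\<omega>. (t e \<omega>)\<^sup>2)" by (rule integrableI_nonneg) (use fin in auto)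
    have "expectation (\<lambda>\<omega>. (t e \<omega>)\<^sup>2) = enn2real (\<integral>\<^sup>+\<omega>. ennreal ((t e \<omega>)\<^sup>2) \<partial>M)"
      by (rule integral_eq_nn_integral) auto
    also have "\<dots> \<le> \<mu>" unfolding \<mu>_def using le assms(5) by (intro enn2real_mono) auto
    finally show ?thesis using i by simp
  qed
  define t' where "t' e \<omega> = \<bar>t e \<omega>\<bar>" for e \<omega>
  interpret first_passage M d t' \<mu>
  proof
    show "d \<ge> 1" by fact
    show "indep_vars (\<lambda>_. borel) t' (edges d)"
      unfolding t'_def by (rule indep_vars_compose2[OF assms(3)]) simp
    show "0 \<le> t' e \<omega>" for e \<omega> by (simp add: t'_def)
    show "integrable M (\<lambda>\<omega>. (t' e \<omega>)\<^sup>2)" "expectation (\<lambda>\<omega>. (t' e \<omega>)\<^sup>2) \<le> \<mu>" if "e \<in> edges d" for e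
      using t2[OF that] by (simp_all add: t'_def)
    fix \<delta> :: real assume "\<delta> > 0"
    then obtain \<epsilon> where \<epsilon>: "\<epsilon> > 0" "\<And>e. e \<in> edges d \<Longrightarrow> prob {\<omega> \<in> space M. t e \<omega> \<le> \<epsilon>} \<le> \<delta>" using small by blast
    have "prob {\<omega> \<in> space M. t' e \<omega> \<le> \<epsilon>} \<le> \<delta>" if e: "e \<in> edges d" for e
    proof -
      have [measurable]: "t e \<in> borel_measurable M" by (rule tm[OF e])
      have "prob {\<omega> \<in> space M. t' e \<omega> \<le> \<epsilon>} \<le> prob {\<omega> \<in> space M. t e \<omega> \<le> \<epsilon>}"
        by (rule finite_measure_mono) (auto simp: t'_def)
      with \<epsilon>(2)[OF e] show ?thesis by simp
    qed
    with \<epsilon>(1) show "\<exists>\<epsilon>>0. \<forall>e\<in>edges d. prob {\<omega> \<in> space M. t' e \<omega> \<le> \<epsilon>} \<le> \<delta>" by blast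
  qed
  from prob_slow obtain c where "c > 0" "\<And>r. prob (slow c r) \<le> (1 / 4) ^ r" by blast
  then interpret first_passage_speed M d t' \<mu> c by unfold_locales
  have [measurable]: "passage_time t ws \<in> borel_measurable M" if "is_path d ws" for ws
    by (rule borel_measurable_passage_time[OF that tm])
  \<comment> \<open>The original weights may be negative on a null set, so measurability is shown
    for their extended real infima directly.\<close>
  have upto_m[measurable]: "min_time_upto d t n k \<in> borel_measurable M" for n k
  proof -
    have "(\<lambda>\<omega>. INF ws\<in>paths_upto d n k. ereal (passage_time t ws \<omega>)) \<in> borel_measurable M"
      by (intro borel_measurable_INF countable_finite[OF finite_paths_upto[OF d]] borel_measurable_ereal)
        (auto simp: paths_upto_def)
    then show ?thesis unfolding min_time_upto_def[abs_def] .
  qed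
  have min_m[measurable]: "min_time d t n \<in> borel_measurable M" for n
    unfolding min_time_def[abs_def] by measurable
  have ae: "AE \<omega> in M. \<forall>n k. min_time d t n \<omega> = min_time d t' n \<omega> \<and> min_time_upto d t n k \<omega> = min_time_upto d t' n k \<omega>"
  proof -
    \<comment> \<open>Paths from the origin use only countably many edges, so a single null set
      serves all \<open>n\<close> and \<open>k\<close> at once, as the almost sure limits
      require.\<close>
    define U where "U = (\<Union>r. \<Union>ws\<in>paths_of_length d r. path_edges ws)"
    have "countable (\<Union>ws\<in>paths_of_length d r. path_edges ws)" for r
      using paths_of_length[OF d, of r] by (intro countable_finite finite_UN_I) auto
    then have "countable U" unfolding U_def by simp
    moreover have "U \<subseteq> edges d"
      unfolding U_def using path_edges_subset by (intro UN_least) (auto simp: paths_of_length_def)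
    ultimately have "AE \<omega> in M. \<forall>e\<in>U. 0 \<le> t e \<omega>"
      using AE_nonneg by (subst AE_ball_countable) auto
    then show ?thesis
    proof eventually_elim
      case (elim \<omega>)
      have "passage_time t ws \<omega> = passage_time t' ws \<omega>" if "ws \<in> paths_upto d n k" for ws n k
      proof -
        have "ws \<in> paths_of_length d (path_length ws)" and dist: "distinct ws"
          using that by (auto simp: paths_upto_def paths_of_length_def is_path_def)
        then have "path_edges ws \<subseteq> U" unfolding U_def by blast
        then show ?thesis using elim unfolding passage_time_eq_sum[OF dist] t'_def by (intro sum.cong) auto
      qed
      then have "min_time_upto d t n k \<omega> = min_time_upto d t' n k \<omega>" for n k
        unfolding min_time_upto_def by (intro INF_cong) auto
      then show ?case unfolding min_time_def by simp
    qed
  qed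
  have ae_min_passage: "AE \<omega> in M. min_time d t n \<omega> = ereal (min_passage n \<omega>)" for n
    using ae by eventually_elim (simp add: min_time_eq)
  have ae_min_passage_upto: "AE \<omega> in M. min_time_upto d t n k \<omega> = ereal (min_passage_upto n k \<omega>)" if "n \<le> k" for n k
    using ae by eventually_elim (simp add: min_time_upto_eq[OF that])
  note min_passage = finite_second_moment_mean_var[OF prob_space_axioms min_m min_passage_measurable ae_min_passage min_passage_square_integrable]
  note min_passage_upto = finite_second_moment_mean_var[OF prob_space_axioms upto_m min_passage_upto_measurable ae_min_passage_upto min_passage_upto_square_integrable]
  have "\<forall>n\<ge>1. finite_second_moment M (min_time d t n) \<and> (\<forall>k\<ge>n. finite_second_moment M (min_time_upto d t n k))"
    using min_passage(1) min_passage_upto(1) by auto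
  moreover have "\<exists>C1>0. \<exists>C2>0. \<forall>n\<ge>1. \<forall>k\<ge>n.
        measure M {\<omega> \<in> space M. ereal (C1 * real n) \<le> min_time d t n \<omega> \<and>
            min_time d t n \<omega> \<le> min_time_upto d t n k \<omega> \<and>
            min_time_upto d t n k \<omega> \<le> ereal (C2 * real n)} \<ge> 1 - C2 / real n \<and>
        var M (min_time_upto d t n k) \<le> C2 * real n \<and>
        C1 * real n \<le> mean M (min_time d t n) \<and>
        mean M (min_time d t n) \<le> mean M (min_time_upto d t n k) \<and>
        mean M (min_time_upto d t n k) \<le> C2 * real n"
  proof -
    \<comment> \<open>One constant for four bounds: concentration, the error \<open>2 / n\<close>,
      the variance and the mean.\<close>
    define C2 where "C2 = 2 * (1 + \<mu>) + variance_const"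
    have C2: "C2 \<ge> 2 * (1 + \<mu>)" "C2 \<ge> 2" "C2 \<ge> variance_const" "C2 \<ge> 1 + \<mu>"
      using \<mu>_nonneg variance_const_nonneg by (auto simp: C2_def)
    show ?thesis
    proof (rule exI[of _ "c / 2"], (rule conjI[OF _ exI[of _ C2]]; (intro conjI allI impI)?))
      show "0 < c / 2" using c by simp
      show "0 < C2" using C2 by simp
      fix n k :: nat assume n: "n \<ge> 1" and nk: "n \<le> k"
      have "1 - C2 / real n \<le> 1 - 2 / real n" using C2 by (simp add: divide_right_mono)
      also have "\<dots> \<le> prob {\<omega> \<in> space M. c / 2 * real n \<le> min_passage n \<omega> \<and> min_passage n \<omega> \<le> min_passage_upto n k \<omega> \<and> min_passage_upto n k \<omega> \<le> C2 * real n}"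
        by (rule concentration[OF n nk C2(1)])
      also have "\<dots> = prob {\<omega> \<in> space M. ereal (c / 2 * real n) \<le> min_time d t n \<omega> \<and>
            min_time d t n \<omega> \<le> min_time_upto d t n k \<omega> \<and>
            min_time_upto d t n k \<omega> \<le> ereal (C2 * real n)}"
      proof (rule finite_measure_eq_AE)
        from ae_min_passage[of n] ae_min_passage_upto[OF nk]
        show "AE \<omega> in M. \<omega> \<in> {\<omega> \<in> space M. c / 2 * real n \<le> min_passage n \<omega> \<and> min_passage n \<omega> \<le> min_passage_upto n k \<omega> \<and> min_passage_upto n k \<omega> \<le> C2 * real n}
          \<longleftrightarrow> \<omega> \<in> {\<omega> \<in> space M. ereal (c / 2 * real n) \<le> min_time d t n \<omega> \<and>
            min_time d t n \<omega> \<le> min_time_upto d t n k \<omega> \<and> min_time_upto d t n k \<omega> \<le> ereal (C2 * real n)}"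
          by eventually_elim simp
      qed measurable
      finally show "1 - C2 / real n \<le> prob {\<omega> \<in> space M. ereal (c / 2 * real n) \<le> min_time d t n \<omega> \<and>
            min_time d t n \<omega> \<le> min_time_upto d t n k \<omega> \<and>
            min_time_upto d t n k \<omega> \<le> ereal (C2 * real n)}" .
      have "variance (min_passage_upto n k) \<le> C2 * real n"
        using variance_min_passage_upto[OF n nk] mult_right_mono[OF C2(3), of "real n"] by simp
      then show "var M (min_time_upto d t n k) \<le> C2 * real n" using min_passage_upto(3)[OF nk nk] by simp
      show "c / 2 * real n \<le> mean M (min_time d t n)" using min_passage_mean_ge[OF n] min_passage(2) by simp
      show "mean M (min_time d t n) \<le> mean M (min_time_upto d t n k)"
        using min_passage_mean_le_min_passage_upto[OF nk] min_passage(2) min_passage_upto(2)[OF nk nk] by simp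
      have "expectation (min_passage_upto n k) \<le> C2 * real n"
        using min_passage_upto_mean_le[OF nk] mult_right_mono[OF C2(4), of "real n"] by simp
      then show "mean M (min_time_upto d t n k) \<le> C2 * real n" using min_passage_upto(2)[OF nk nk] by simp
    qed
  qed
  moreover have "\<exists>length_const>0. \<forall>n\<ge>1. \<forall>k::nat. real k \<ge> length_const * real n \<longrightarrow>
        measure M {\<omega> \<in> space M. min_time d t n \<omega> \<noteq> min_time_upto d t n k \<omega>} \<le> length_const / real k"
  proof (intro exI[of _ length_const] conjI allI impI)
    fix n k :: nat assume n: "n \<ge> 1" and k: "real k \<ge> length_const * real n"
    have "1 * real n \<le> length_const * real n" using length_const by (intro mult_right_mono) auto
    with k have nk: "n \<le> k" by simp
    have "prob {\<omega> \<in> space M. min_time d t n \<omega> \<noteq> min_time_upto d t n k \<omega>} = prob {\<omega> \<in> space M. min_passage n \<omega> \<noteq> min_passage_upto n k \<omega>}"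
    proof (rule finite_measure_eq_AE)
      from ae_min_passage[of n] ae_min_passage_upto[OF nk]
      show "AE \<omega> in M. \<omega> \<in> {\<omega> \<in> space M. min_time d t n \<omega> \<noteq> min_time_upto d t n k \<omega>}
          \<longleftrightarrow> \<omega> \<in> {\<omega> \<in> space M. min_passage n \<omega> \<noteq> min_passage_upto n k \<omega>}"
        by eventually_elim simp
    qed measurable
    then show "prob {\<omega> \<in> space M. min_time d t n \<omega> \<noteq> min_time_upto d t n k \<omega>} \<le> length_const / real k"
      using prob_min_passage_neq[OF n k] by simp
  qed (rule length_const(2))
  moreover have "\<forall>k::nat \<Rightarrow> nat. (\<exists>\<epsilon>>0. \<forall>n\<ge>1. real (k n) \<ge> real n powr (1 + \<epsilon>)) \<longrightarrow>
        (AE \<omega> in M. (\<lambda>n. (real_of_ereal (min_time_upto d t n (k n) \<omega>)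
            - mean M (min_time_upto d t n (k n))) / real n) \<longlonglongrightarrow> 0) \<and>
        (AE \<omega> in M. (\<lambda>n. (real_of_ereal (min_time d t n \<omega>) - mean M (min_time d t n)) / real n) \<longlonglongrightarrow> 0)"
  proof (intro allI impI conjI)
    fix k :: "nat \<Rightarrow> nat" assume "\<exists>\<epsilon>>0. \<forall>n\<ge>1. real (k n) \<ge> real n powr (1 + \<epsilon>)"
    then obtain \<epsilon> where \<epsilon>: "\<epsilon> > 0" and k: "\<And>n. n \<ge> 1 \<Longrightarrow> real (k n) \<ge> real n powr (1 + \<epsilon>)" by blast
    have nk: "n \<le> k n" if "n \<ge> 1" for n
    proof -
      have "real n powr 1 \<le> real n powr (1 + \<epsilon>)" using that \<epsilon> by (intro powr_mono) auto
      then show ?thesis using k[OF that] that by simp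
    qed
    have "AE \<omega> in M. (\<lambda>n. (min_passage_upto n (k n) \<omega> - expectation (min_passage_upto n (k n))) / real n) \<longlonglongrightarrow> 0"
      by (rule min_passage_upto_lln[OF \<epsilon> k])
    with ae show "AE \<omega> in M. (\<lambda>n. (real_of_ereal (min_time_upto d t n (k n) \<omega>)
        - mean M (min_time_upto d t n (k n))) / real n) \<longlonglongrightarrow> 0"
    proof eventually_elim
      case (elim \<omega>)
      note same = elim(1)
      show ?case
      proof (rule Lim_transform_eventually[OF elim(2)])
        \<comment> \<open>Growth of \<open>k\<close> is assumed for \<open>n \<ge> 1\<close>, so the
          identity is claimed eventually.\<close>
        show "\<forall>\<^sub>F n in sequentially. (min_passage_upto n (k n) \<omega> - expectation (min_passage_upto n (k n))) / real n
          = (real_of_ereal (min_time_upto d t n (k n) \<omega>) - mean M (min_time_upto d t n (k n))) / real n"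
          using eventually_ge_at_top[of 1]
        proof eventually_elim
          case (elim n)
          with nk[of n] min_passage_upto(2)[of n "k n"] same show ?case by (simp add: min_time_upto_eq)
        qed
      qed
    qed
    from ae min_passage_lln
    show "AE \<omega> in M. (\<lambda>n. (real_of_ereal (min_time d t n \<omega>) - mean M (min_time d t n)) / real n) \<longlonglongrightarrow> 0"
      by eventually_elim (simp add: min_time_eq min_passage(2))
  qed
  moreover have "(\<lambda>n. var M (\<lambda>\<omega>. min_time d t n \<omega> / ereal (real n))) \<longlonglongrightarrow> 0"
  proof (rule Lim_null_comparison)
    show "(\<lambda>n. variance_const / real n) \<longlonglongrightarrow> 0" by (rule lim_const_over_n)
    show "\<forall>\<^sub>F n in sequentially. norm (var M (\<lambda>\<omega>. min_time d t n \<omega> / ereal (real n))) \<le> variance_const / real n"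
      using eventually_ge_at_top[of 1]
    proof eventually_elim
      case (elim n)
      have ae_n: "AE \<omega> in M. min_time d t n \<omega> / ereal (real n) = ereal (min_passage n \<omega> / real n)"
        using ae_min_passage[of n] by eventually_elim (use elim in simp)
      have "var M (\<lambda>\<omega>. min_time d t n \<omega> / ereal (real n)) = variance (\<lambda>\<omega>. min_passage n \<omega> / real n)"
        by (rule finite_second_moment_mean_var(3)[OF prob_space_axioms _ _ ae_n])
          (use min_passage_square_integrable[of n] in \<open>simp_all add: power_divide\<close>)
      also have "\<dots> = expectation (\<lambda>\<omega>. (min_passage n \<omega> - expectation (min_passage n))\<^sup>2 / (real n)\<^sup>2)"
        by (simp add: diff_divide_distrib[symmetric] power_divide)
      also have "\<dots> = variance (min_passage n) / (real n)\<^sup>2" by simp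
      finally have eq: "var M (\<lambda>\<omega>. min_time d t n \<omega> / ereal (real n)) = variance (min_passage n) / (real n)\<^sup>2" .
      also have "\<dots> \<le> variance_const * real n / (real n)\<^sup>2" by (intro divide_right_mono variance_min_passage elim) simp
      also have "\<dots> = variance_const / real n" using elim by (simp add: power2_eq_square)
      finally show ?case using eq variance_positive[of "min_passage n"] by simp
    qed
  qed
  moreover have "\<exists>C>0. \<forall>n\<ge>1. var M (min_time d t n) \<le> C * real n"
  \<comment> \<open>\<open>variance_const\<close> is only known to be nonnegative; adding 1 makes
    the witness positive.\<close>
  proof (intro exI[of _ "variance_const + 1"] conjI allI impI)
    show "0 < variance_const + 1" using variance_const_nonneg by simp
    show "var M (min_time d t n) \<le> (variance_const + 1) * real n" if "n \<ge> 1" for n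
      using variance_min_passage[OF that] min_passage(3)[of n] by (simp add: algebra_simps)
  qed
  ultimately show ?thesis by blast
qed

end
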